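(* It holds that $$\Lambda^+\le\inf_{L\in\mathcal{L}}\lambda(L,\Omega)\le\sup_{L\in\mathcal{L}}\lambda(L,\Omega)\le\Lambda^-.$$
   Context: Fix the dimension $d$, $s\in(0,1)$ and $0<\lambda\le\Lambda$. Let $\mathcal{L}_*$ be the class of all operators $$Lu(x)=\frac12\int_{\mathbb{R}^d}\bigl(u(x+y)+u(x-y)-2u(x)\bigr)\frac{k(y/|y|)}{|y|^{d+2s}}\,dy,$$ where $k\in L^\infty(S^{d-1})$, $\lambda\le k\le\Lambda$ and $k(y)=k(-y)$. Let $\mathcal{L}\subset\mathcal{L}_*$ be a nonempty subclass and $\mathbf{I}u=\sup_{L\in\mathcal{L}}Lu$. $\Omega\subset\mathbb{R}^d$ is a bounded (connected) domain with smooth boundary. $L^1(\omega)$ is the set of functions integrable with respect to the weight $\omega(y)=(1+|y|)^{-d-2s}$. All (in)equalities are in the viscosity sense: $\mathbf{I}u\ge f$ in $\Omega$ means that whenever $x_0\in\Omega$, $N\subset\Omega$ is a neighbourhood of $x_0$, and $\varphi\in\mathcal{C}^2(\bar N)$ satisfies $\varphi(x_0)=u(x_0)$ and $\varphi>u$ in $N\setminus\{x_0\}$, the function $v$ equal to $\varphi$ in $N$ and $u$ in $N^c$ satisfies $\mathbf{I}v(x_0)\ge f(x_0)$; $\mathbf{I}u\le f$ is defined symmetrically (touching from below, reversed inequality), and $\mathbf{I}u=f$ means both. Define $$\Lambda^+=\sup\{\mu\in\mathbb{R}:\exists\,\psi\in\mathcal{C}(\mathbb{R}^d)\cap L^1(\omega),\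 \psi\ge0,\ \psi>0\text{ in }\Omega,\ \mathbf{I}\psi+\mu\psi\le0\text{ in }\Omega\},$$ $$\Lambda^-=\sup\{\mu\in\mathbb{R}:\exists\,\psi\in\mathcal{C}(\mathbb{R}^d)\cap L^1(\omega),\ \psi\le0,\ \psi<0\text{ in }\Omega,\ \mathbf{I}\psi+\mu\psi\ge0\text{ in }\Omega\}.$$ For $L\in\mathcal{L}$, $\lambda(L,\Omega)$ denotes the principal eigenvalue of the linear operator $L$ in $\Omega$ with Dirichlet exterior condition: the unique real number for which there is a continuous function $\Psi_L$ on $\mathbb{R}^d$ with $L\Psi_L+\lambda(L,\Omega)\Psi_L=0$ in $\Omega$, $\Psi_L>0$ in $\Omega$, $\Psi_L=0$ in $\Omega^c$. *)

theory Defs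
  imports "HOL-Analysis.Analysis"
begin

text \<open>
  \<open>Ck_closure k f U\<close>, for open \<open>U\<close>, is the usual \<open>f \<in> C^k(closure U)\<close>: \<open>f\<close> is k times continuously
  differentiable in \<open>U\<close>, and \<open>f\<close> and its derivatives up to order k extend continuously to \<open>closure U\<close>.
  The values of the gradient field \<open>G\<close> on \<open>closure U - U\<close> are those of the continuous extension.
  For \<open>U = UNIV\<close> this is \<open>C^k\<close> on the whole space.
\<close>

primrec Ck_closure :: "nat \<Rightarrow> (real^'n \<Rightarrow> real) \<Rightarrow> (real^'n) set \<Rightarrow> bool" where
  "Ck_closure 0 f U \<longleftrightarrow> continuous_on (closure U) f"
| "Ck_closure (Suc k) f U \<longleftrightarrow>
     continuous_on (closure U) f \<and>
     (\<exists>G :: real^'n \<Rightarrow> real^'n.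
        (\<forall>x\<in>U. (f has_derivative (\<lambda>h. G x \<bullet> h)) (at x)) \<and>
        (\<forall>i. Ck_closure k (\<lambda>x. G x $ i) U))"

text \<open>
  Near each boundary point the set is, after a rotation, the strict epigraph of a smooth function of the
  remaining variables. The direction \<open>e\<close> plays the role of the last coordinate axis and
  \<open>x - (x \<bullet> e) *\<^sub>R e\<close> that of the first \<open>d - 1\<close> coordinates; only the values of \<open>\<gamma>\<close> on the hyperplane
  orthogonal to \<open>e\<close> matter.
\<close>

definition smooth_boundary :: "(real^'n) set \<Rightarrow> bool" where
  "smooth_boundary \<Omega> \<longleftrightarrow>
     (\<forall>z\<in>frontier \<Omega>. \<exists>r>0. \<exists>e \<gamma>. norm e = 1 \<and> (\<forall>k. Ck_closure k \<gamma> UNIV) \<and>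
        \<Omega> \<inter> ball z r = {x \<in> ball z r. \<gamma> (x - (x \<bullet> e) *\<^sub>R e) < x \<bullet> e})"

definition smooth_bounded_domain :: "(real^'n) set \<Rightarrow> bool" where
  "smooth_bounded_domain \<Omega> \<longleftrightarrow>
     open \<Omega> \<and> connected \<Omega> \<and> \<Omega> \<noteq> {} \<and> bounded \<Omega> \<and> smooth_boundary \<Omega>"

definition L1_weighted :: "real \<Rightarrow> (real^'n \<Rightarrow> real) \<Rightarrow> bool" where
  "L1_weighted s u \<longleftrightarrow>
     integrable lborel (\<lambda>y. u y * (1 + norm y) powr (- real CARD('n) - 2 * s))"

text \<open>
  At \<open>y = 0\<close> the integrand is 0 by convention, which does not affect the integral.
\<close>

definition stable_op ::
  "real \<Rightarrow> (real^'n \<Rightarrow> real) \<Rightarrow> (real^'n \<Rightarrow> real) \<Rightarrow> real^'n \<Rightarrow> real" where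
  "stable_op s k u x =
     1/2 * (\<integral>y. (u (x + y) + u (x - y) - 2 * u x) *
                (k (y /\<^sub>R norm y) / norm y powr (real CARD('n) + 2 * s)) \<partial>lborel)"

text \<open>
  The class of operators with kernel \<open>k \<in> L^\<infinity>(S^(d-1))\<close>, \<open>lo \<le> k \<le> hi\<close>, \<open>k\<close> even. Such a \<open>k\<close>, given
  up to null sets of the sphere, has a Borel representative that satisfies the bounds and the symmetry
  everywhere, and the operator does not depend on the representative. The values of \<open>k\<close> off the unit
  sphere are irrelevant.
\<close>

definition stable_ops ::
  "real \<Rightarrow> real \<Rightarrow> real \<Rightarrow> ((real^'n \<Rightarrow> real) \<Rightarrow> real^'n \<Rightarrow> real) set" where
  "stable_ops s lo hi =
     {stable_op s k | k.
        k \<in> borel_measurable (restrict_space borel (sphere 0 1)) \<and>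
        (\<forall>\<theta>\<in>sphere 0 1. lo \<le> k \<theta> \<and> k \<theta> \<le> hi \<and> k (- \<theta>) = k \<theta>)}"

text \<open>
  The supremum is a real one. For a nonempty subclass of \<open>stable_ops s lo hi\<close> and a function that is
  \<open>C^2\<close> near \<open>x\<close> and in the weighted \<open>L^1\<close> space, the integrals converge absolutely and are
  bounded uniformly over the class. This covers the test functions occurring below.
\<close>

definition sup_op ::
  "((real^'n \<Rightarrow> real) \<Rightarrow> real^'n \<Rightarrow> real) set \<Rightarrow> (real^'n \<Rightarrow> real) \<Rightarrow> real^'n \<Rightarrow> real" where
  "sup_op \<L> u x = (SUP L\<in>\<L>. L u x)"

definition visc_ge ::
  "((real^'n \<Rightarrow> real) \<Rightarrow> real^'n \<Rightarrow> real) \<Rightarrow> (real^'n) set \<Rightarrow>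
   (real^'n \<Rightarrow> real) \<Rightarrow> (real^'n \<Rightarrow> real) \<Rightarrow> bool" where
  "visc_ge I \<Omega> u f \<longleftrightarrow>
     (\<forall>x0\<in>\<Omega>. \<forall>N \<phi>.
        open N \<and> x0 \<in> N \<and> N \<subseteq> \<Omega> \<and> Ck_closure 2 \<phi> N \<and>
        \<phi> x0 = u x0 \<and> (\<forall>x\<in>N - {x0}. \<phi> x > u x) \<longrightarrow>
        I (\<lambda>x. if x \<in> N then \<phi> x else u x) x0 \<ge> f x0)"

definition visc_le ::
  "((real^'n \<Rightarrow> real) \<Rightarrow> real^'n \<Rightarrow> real) \<Rightarrow> (real^'n) set \<Rightarrow>
   (real^'n \<Rightarrow> real) \<Rightarrow> (real^'n \<Rightarrow> real) \<Rightarrow> bool" where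
  "visc_le I \<Omega> u f \<longleftrightarrow>
     (\<forall>x0\<in>\<Omega>. \<forall>N \<phi>.
        open N \<and> x0 \<in> N \<and> N \<subseteq> \<Omega> \<and> Ck_closure 2 \<phi> N \<and>
        \<phi> x0 = u x0 \<and> (\<forall>x\<in>N - {x0}. \<phi> x < u x) \<longrightarrow>
        I (\<lambda>x. if x \<in> N then \<phi> x else u x) x0 \<le> f x0)"

definition visc_eq ::
  "((real^'n \<Rightarrow> real) \<Rightarrow> real^'n \<Rightarrow> real) \<Rightarrow> (real^'n) set \<Rightarrow>
   (real^'n \<Rightarrow> real) \<Rightarrow> (real^'n \<Rightarrow> real) \<Rightarrow> bool" where
  "visc_eq I \<Omega> u f \<longleftrightarrow> visc_ge I \<Omega> u f \<and> visc_le I \<Omega> u f"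

text \<open>
  An inequality \<open>I \<psi> + \<mu> \<psi> \<le> 0\<close> is read as \<open>I \<psi> \<le> - \<mu> \<psi>\<close>, and similarly below. The suprema are taken
  in the extended reals.
\<close>

definition Lambda_plus ::
  "real \<Rightarrow> (real^'n) set \<Rightarrow> ((real^'n \<Rightarrow> real) \<Rightarrow> real^'n \<Rightarrow> real) set \<Rightarrow> ereal" where
  "Lambda_plus s \<Omega> \<L> =
     Sup (ereal ` {\<mu>. \<exists>\<psi>. continuous_on UNIV \<psi> \<and> L1_weighted s \<psi> \<and>
        (\<forall>x. \<psi> x \<ge> 0) \<and> (\<forall>x\<in>\<Omega>. \<psi> x > 0) \<and>
        visc_le (sup_op \<L>) \<Omega> \<psi> (\<lambda>x. - \<mu> * \<psi> x)})"

definition Lambda_minus ::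
  "real \<Rightarrow> (real^'n) set \<Rightarrow> ((real^'n \<Rightarrow> real) \<Rightarrow> real^'n \<Rightarrow> real) set \<Rightarrow> ereal" where
  "Lambda_minus s \<Omega> \<L> =
     Sup (ereal ` {\<mu>. \<exists>\<psi>. continuous_on UNIV \<psi> \<and> L1_weighted s \<psi> \<and>
        (\<forall>x. \<psi> x \<le> 0) \<and> (\<forall>x\<in>\<Omega>. \<psi> x < 0) \<and>
        visc_ge (sup_op \<L>) \<Omega> \<psi> (\<lambda>x. - \<mu> * \<psi> x)})"

definition is_principal_eigenvalue ::
  "((real^'n \<Rightarrow> real) \<Rightarrow> real^'n \<Rightarrow> real) \<Rightarrow> (real^'n) set \<Rightarrow> real \<Rightarrow> bool" where
  "is_principal_eigenvalue L \<Omega> m \<longleftrightarrow>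
     (\<exists>\<Psi>. continuous_on UNIV \<Psi> \<and> visc_eq L \<Omega> \<Psi> (\<lambda>x. - m * \<Psi> x) \<and>
        (\<forall>x\<in>\<Omega>. \<Psi> x > 0) \<and> (\<forall>x\<in>- \<Omega>. \<Psi> x = 0))"

end

theory Submission
  imports Defs
begin

text \<open>
  For \<open>\<Lambda>\<^sup>-\<close>, the function \<open>- \<Psi>\<^sub>L\<close> is admissible with \<open>\<mu> = \<lambda>(L, \<Omega>)\<close>, as \<open>L \<le> I\<close>.

  For \<open>\<Lambda>\<^sup>+\<close>, let \<open>\<psi>\<close> be admissible with \<open>\<mu> > m = \<lambda>(L, \<Omega>)\<close> and \<open>\<Psi> = \<Psi>\<^sub>L\<close>. At a positive maximum of
  \<open>c \<Psi> - \<psi>\<close>, doubling of variables gives \<open>\<mu> \<psi> \<le> m c \<Psi>\<close> at a point with \<open>\<psi> < c \<Psi>\<close>; if in addition \<open>c\<close>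
  is small, the positivity set is a thin boundary layer and the jumps out of it contradict the
  maximum, so \<open>c \<Psi> \<le> \<psi>\<close> for some \<open>c > 0\<close>. Let \<open>C\<close> be the largest such \<open>c\<close>. For \<open>c > C\<close> the contact point
  satisfies \<open>\<mu> C \<Psi> \<le> \<mu> \<psi> \<le> m c \<Psi>\<close> if \<open>\<mu> \<ge> 0\<close>, and \<open>c \<rightarrow> C\<close> gives \<open>\<mu> \<le> m\<close>; if \<open>\<mu> < 0\<close>, already
  \<open>\<mu> c \<Psi> \<le> \<mu> \<psi> \<le> m c \<Psi>\<close>. Neither a strong maximum principle nor boundary regularity of the solutions enters.
\<close>

section \<open>Integrability of radial weights\<close>

text \<open>Off the origin, a null set, |f| is below the series of \<open>c n\<close> times the
  indicator of \<open>ball 0 (r n)\<close>. Monotone convergence turns its integral into the sum of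
  \<open>c n\<close> times the ball volumes. With dyadic radii this serves both at the origin and at
  infinity.\<close>

lemma integrable_if_dominated_on_balls:
  fixes f :: "'a::euclidean_space \<Rightarrow> real"
  assumes f: "f \<in> borel_measurable borel"
    and c: "\<And>n. 0 \<le> c n" and r: "\<And>n. 0 \<le> r n"
    and dom: "\<And>z. z \<noteq> 0 \<Longrightarrow> \<exists>n::nat. (norm z < r n \<and> \<bar>f z\<bar> \<le> c n) \<or> f z = 0"
    and sm: "summable (\<lambda>n. c n * r n ^ DIM('a))"
  shows "integrable lborel f"
proof (rule integrableI_bounded)
  show "f \<in> borel_measurable lborel" using f by simp
  let ?V = "unit_ball_vol (real DIM('a))"
  have ae: "AE z in lborel. ennreal (norm (f z)) \<le> (\<Sum>n. ennreal (c n) * indicator (ball 0 (r n)) z)"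
  proof (rule AE_mp[OF AE_lborel_singleton[of "0::'a"]], intro AE_I2 impI)
    fix z :: 'a assume "z \<noteq> 0"
    then obtain n where n: "(norm z < r n \<and> \<bar>f z\<bar> \<le> c n) \<or> f z = 0" using dom by blast
    show "ennreal (norm (f z)) \<le> (\<Sum>n. ennreal (c n) * indicator (ball 0 (r n)) z)"
    proof (cases "f z = 0")
      case False
      with n have n: "norm z < r n" "\<bar>f z\<bar> \<le> c n" by auto
      have "ennreal (norm (f z)) \<le> ennreal (c n) * indicator (ball 0 (r n)) z"
        using n by (auto simp: ennreal_leI)
      also have "\<dots> = (\<Sum>m\<in>{n}. ennreal (c m) * indicator (ball 0 (r m)) z)"
        by (simp del: sum_mult_indicator)
      also have "\<dots> \<le> (\<Sum>n. ennreal (c n) * indicator (ball 0 (r n)) z)"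
        by (rule sum_le_suminf) auto
      finally show ?thesis .
    qed simp
  qed
  have "(\<integral>\<^sup>+z. ennreal (norm (f z)) \<partial>lborel)
      \<le> (\<integral>\<^sup>+z. (\<Sum>n. ennreal (c n) * indicator (ball (0::'a) (r n)) z) \<partial>lborel)"
    using ae by (intro nn_integral_mono_AE)
  also have "\<dots> = (\<Sum>n. \<integral>\<^sup>+z. ennreal (c n) * indicator (ball (0::'a) (r n)) z \<partial>lborel)"
    by (rule nn_integral_suminf) (intro borel_measurable_times_ennreal borel_measurable_indicator, auto)
  also have "\<dots> = (\<Sum>n. ennreal (c n * (?V * r n ^ DIM('a))))"
  proof (rule suminf_cong)
    fix n
    have "(\<integral>\<^sup>+z. ennreal (c n) * indicator (ball (0::'a) (r n)) z \<partial>lborel)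
        = ennreal (c n) * emeasure lborel (ball (0::'a) (r n))"
      by (rule nn_integral_cmult_indicator) auto
    also have "\<dots> = ennreal (c n * (?V * r n ^ DIM('a)))"
      using emeasure_ball[OF r[of n], of "0::'a"] c by (simp add: ennreal_mult' flip: emeasure_lborel_UNIV)
    finally show "(\<integral>\<^sup>+z. ennreal (c n) * indicator (ball (0::'a) (r n)) z \<partial>lborel)
        = ennreal (c n * (?V * r n ^ DIM('a)))" .
  qed
  also have "\<dots> = ennreal (\<Sum>n. c n * (?V * r n ^ DIM('a)))"
  proof (rule suminf_ennreal2)
    show "0 \<le> c n * (?V * r n ^ DIM('a))" for n using c r by (simp add: less_imp_le)
    show "summable (\<lambda>n. c n * (?V * r n ^ DIM('a)))"
      using summable_mult[OF sm, of ?V] by (simp add: ac_simps)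
  qed
  finally show "(\<integral>\<^sup>+z. ennreal (norm (f z)) \<partial>lborel) < \<infinity>"
    by (simp add: order_le_less_trans)
qed

text \<open>Each dyadic shell, enclosed in its outer ball, contributes a geometric term of ratio
  2^(q - 2 - d). For q = d + 2s convergence is the condition s < 1.\<close>

lemma integrable_norm_square_over_powr:
  fixes q :: real
  assumes q: "0 \<le> q" "q < DIM('a::euclidean_space) + 2"
  shows "integrable lborel (\<lambda>z::'a. indicator (ball 0 1) z * ((norm z)\<^sup>2 / norm z powr q))"
proof (rule integrable_if_dominated_on_balls[where r = "\<lambda>n. (1/2)^n"
        and c = "\<lambda>n. ((1/2)^n)\<^sup>2 / ((1/2)^Suc n) powr q"])
  fix z :: 'a assume z: "z \<noteq> 0"
  show "\<exists>n. (norm z < (1/2)^n \<and> \<bar>indicator (ball 0 1) z * ((norm z)\<^sup>2 / norm z powr q)\<bar>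
            \<le> ((1/2)^n)\<^sup>2 / ((1/2)^Suc n) powr q)
           \<or> indicator (ball 0 1) z * ((norm z)\<^sup>2 / norm z powr q) = 0"
  proof (cases "norm z < 1")
    case True
    obtain m where m: "(1/2)^m < norm z" using z real_arch_pow_inv[of "norm z" "1/2"] by auto
    \<comment> \<open>As |z| < 1, the least index is not 0; it and its predecessor enclose |z| in
      one shell.\<close>
    define n where "n = (LEAST m. (1/2)^m \<le> norm z)"
    have n1: "(1/2)^n \<le> norm z" unfolding n_def by (rule LeastI[of _ m]) (use m in auto)
    then have "n \<noteq> 0" using True by (cases n) auto
    then obtain k where k: "n = Suc k" by (cases n) auto
    have "\<not> (1/2)^k \<le> norm z" using not_less_Least[of k "\<lambda>m. (1/2)^m \<le> norm z"] k n_def by auto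
    then have k2: "norm z < (1/2)^k" by simp
    have "(norm z)\<^sup>2 / norm z powr q \<le> ((1/2)^k)\<^sup>2 / ((1/2)^Suc k) powr q"
      using k2 n1 k q z by (intro frac_le power_mono powr_mono2) auto
    then show ?thesis using True k2 by (intro exI[of _ k]) (auto simp: indicator_def)
  qed (auto simp: indicator_def)
next
  have "((1/2)^n)\<^sup>2 / ((1/2)^Suc n) powr q * ((1/2)^n) ^ DIM('a)
      = 2 powr q * (2 powr (q - 2 - DIM('a))) ^ n" for n
    by (simp add: powr_realpow[symmetric] powr_powr powr_divide powr_mult powr_minus
          powr_diff field_simps flip: powr_add power_mult)
  moreover have "summable (\<lambda>n. 2 powr q * (2 powr (q - 2 - DIM('a))) ^ n)"
    using q by (intro summable_mult summable_geometric) (simp add: powr_less_one)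
  ultimately show "summable (\<lambda>n. ((1/2)^n)\<^sup>2 / ((1/2)^Suc n) powr q * ((1/2)^n) ^ DIM('a))"
    by simp
  show "(\<lambda>z::'a. indicator (ball 0 1) z * ((norm z)\<^sup>2 / norm z powr q)) \<in> borel_measurable borel"
    by (intro borel_measurable_times borel_measurable_indicator borel_measurable_divide
        borel_measurable_power powr_real_measurable) auto
qed simp_all

text \<open>The balls now grow by the factor 2 and the ratio is 2^(d - q). For q = d + 2s the sum
  converges because s > 0.\<close>

lemma integrable_weight:
  fixes q :: real
  assumes q: "DIM('a::euclidean_space) < q"
  shows "integrable lborel (\<lambda>z::'a. (1 + norm z) powr (-q))"
proof (rule integrable_if_dominated_on_balls[where r = "\<lambda>n. 2^n" and c = "\<lambda>n. (2^n / 2) powr (-q)"])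
  fix z :: 'a assume z: "z \<noteq> 0"
  obtain m where m: "norm z < 2^m" using real_arch_pow[of 2 "norm z"] by auto
  define n where "n = (LEAST m. norm z < 2^m)"
  have n1: "norm z < 2^n" unfolding n_def by (rule LeastI[of _ m]) (use m in auto)
  \<comment> \<open>For n > 0 minimality gives 2^(n-1) \<le> |z|; for n = 0 the summand 1 of the
    weight takes over.\<close>
  have "2^n / 2 \<le> 1 + norm z"
  proof (cases n)
    case (Suc k)
    have "\<not> norm z < 2^k" using not_less_Least[of k "\<lambda>m. norm z < 2^m"] Suc n_def by auto
    then show ?thesis using Suc by simp
  next
    case 0
    have "2^0 / 2 \<le> (1::real)" by simp
    then show ?thesis using 0 norm_ge_zero[of z] by (simp del: norm_ge_zero)
  qed
  then have "(1 + norm z) powr (-q) \<le> (2^n / 2) powr (-q)"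
    using q by (intro powr_mono2') (auto simp: order_trans[OF of_nat_0_le_iff])
  then show "\<exists>n. (norm z < 2^n \<and> \<bar>(1 + norm z) powr (-q)\<bar> \<le> (2^n / 2) powr (-q)) \<or> (1 + norm z) powr (-q) = 0"
    using n1 by (intro exI[of _ n]) auto
next
  have "(2^n / 2) powr (-q) * (2^n) ^ DIM('a) = 2 powr q * (2 powr (DIM('a) - q)) ^ n" for n
    by (simp add: powr_realpow[symmetric] powr_powr powr_divide powr_mult powr_minus
          powr_diff field_simps flip: powr_add power_mult)
  moreover have "summable (\<lambda>n. 2 powr q * (2 powr (DIM('a) - q)) ^ n)"
    using q by (intro summable_mult summable_geometric) (simp add: powr_less_one)
  ultimately show "summable (\<lambda>n. (2^n / 2) powr (-q) * (2^n) ^ DIM('a))"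
    by simp
qed auto

section \<open>Translates, reflections and second differences\<close>

lemma integrable_translate:
  fixes g :: "'a::euclidean_space \<Rightarrow> real"
  assumes "integrable lborel g"
  shows "integrable lborel (\<lambda>z. g (x + z))"
proof -
  have "integrable (distr lborel borel ((+) x)) g" using assms by (simp add: lborel_distr_plus)
  then show ?thesis by (subst (asm) integrable_distr_eq) (use assms in \<open>auto dest: borel_measurable_integrable\<close>)
qed

lemma distr_lborel_diff: "distr lborel borel (\<lambda>z::'a::euclidean_space. x - z) = lborel"
  by (subst (2) lborel_affine[of "-1" x]) (auto simp: density_1)

lemma integrable_reflect:
  fixes g :: "'a::euclidean_space \<Rightarrow> real"
  assumes "integrable lborel g"
  shows "integrable lborel (\<lambda>z. g (x - z))"
proof -
  have "integrable (distr lborel borel (\<lambda>z. x - z)) g" using assms by (simp add: distr_lborel_diff)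
  then show ?thesis by (subst (asm) integrable_distr_eq) (use assms in \<open>auto dest: borel_measurable_integrable\<close>)
qed

lemma emeasure_lborel_reflect_translate:
  fixes A :: "'a::euclidean_space set"
  assumes "A \<in> sets borel"
  shows "emeasure lborel ((\<lambda>z. x - z) -` A) = emeasure lborel A"
    and "emeasure lborel ((\<lambda>z. x + z) -` A) = emeasure lborel A"
proof -
  have "emeasure (distr lborel borel (\<lambda>z. x - z)) A = emeasure lborel ((\<lambda>z. x - z) -` A)"
    using assms by (subst emeasure_distr) auto
  then show "emeasure lborel ((\<lambda>z. x - z) -` A) = emeasure lborel A" by (simp add: distr_lborel_diff)
  have "emeasure (distr lborel borel ((+) x)) A = emeasure lborel ((+) x -` A)"
    using assms by (subst emeasure_distr) auto
  then show "emeasure lborel ((\<lambda>z. x + z) -` A) = emeasure lborel A" by (simp add: lborel_distr_plus)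
qed

text \<open>Near the origin the quadratic bound lowers the singularity by two orders. Away from it
  the three terms are integrated separately, because |z|^(-q) is there dominated by the weight at x
  + z, x - z and z.\<close>

lemma second_difference_integrable:
  fixes u :: "real^'n \<Rightarrow> real"
  assumes s: "0 < s" "s < 1" and u: "u \<in> borel_measurable borel" "L1_weighted s u"
    and e: "0 < e"
    and C': "\<And>z. norm z < e \<Longrightarrow> \<bar>u (x + z) + u (x - z) - 2 * u x\<bar> \<le> C * (norm z)\<^sup>2"
  shows "integrable lborel (\<lambda>z. (u (x + z) + u (x - z) - 2 * u x) / norm z powr (real CARD('n) + 2 * s))"
    (is "integrable lborel ?f")
proof -
  define \<delta> where "\<delta> = min e 1"
  have \<delta>: "0 < \<delta>" "\<delta> \<le> 1" using e by (auto simp: \<delta>_def)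
  have C: "\<bar>u (x + z) + u (x - z) - 2 * u x\<bar> \<le> C * (norm z)\<^sup>2" if "norm z < \<delta>" for z
    using C' that by (simp add: \<delta>_def)
  define q where "q = real CARD('n) + 2 * s"
  have q: "0 \<le> q" "q < DIM(real^'n) + 2" "DIM(real^'n) < q" using s by (auto simp: q_def)
  have "0 \<le> C"
  proof -
    define z :: "real^'n" where "z = (\<delta>/2) *\<^sub>R axis undefined 1"
    have z: "norm z = \<delta>/2" using \<delta> by (simp add: z_def)
    have "0 \<le> C * (norm z)\<^sup>2" by (rule order_trans[OF abs_ge_zero C]) (use z \<delta> in simp)
    then show ?thesis using z \<delta> by (simp add: zero_le_mult_iff)
  qed
  define w where "w = (\<lambda>z::real^'n. (1 + norm z) powr (-q))"
  \<comment> \<open>For |z| \<ge> \<delta> and |y| \<le> |x| + |z| one has 1 + |y| \<le> |z| ((1 +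
    |x|) / \<delta> + 1); \<open>A\<close> is the q-th power of the last factor.\<close>
  define A where "A = ((1 + norm x) / \<delta> + 1) powr q"
  have far: "1 / norm z powr q \<le> A * w y" if "\<delta> \<le> norm z" "norm y \<le> norm x + norm z" for y z :: "real^'n"
  proof -
    have "1 + norm y \<le> norm z * ((1 + norm x) / \<delta> + 1)"
    proof -
      have "(1 + norm x) * 1 \<le> (1 + norm x) * (norm z / \<delta>)"
        using that \<delta> by (intro mult_left_mono) auto
      then show ?thesis using that by (simp add: algebra_simps add_divide_distrib)
    qed
    then have "(1 + norm y) powr q \<le> (norm z * ((1 + norm x) / \<delta> + 1)) powr q"
      using q by (intro powr_mono2) auto
    also have "\<dots> = norm z powr q * A" using \<delta> by (simp add: A_def powr_mult)
    finally have "(1 + norm y) powr q \<le> norm z powr q * A" .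
    moreover have "0 < norm z powr q" "0 < (1 + norm y) powr q" using that \<delta> add_pos_nonneg[OF zero_less_one norm_ge_zero[of y]] by auto
    ultimately show ?thesis by (simp add: w_def powr_minus field_simps)
  qed
  have A0: "0 \<le> A" and w0: "0 \<le> w y" for y by (auto simp: A_def w_def)
  have wu: "integrable lborel (\<lambda>y. \<bar>u y\<bar> * w y)"
    using integrable_abs[OF u(2)[unfolded L1_weighted_def]] by (simp add: abs_mult w_def q_def)
  define g where "g = (\<lambda>z. C * (indicator (ball 0 1) z * ((norm z)\<^sup>2 / norm z powr q))
      + A * (\<bar>u (x + z)\<bar> * w (x + z)) + A * (\<bar>u (x - z)\<bar> * w (x - z)) + A * (2 * \<bar>u x\<bar> * w z))"
  have "integrable lborel g" unfolding g_def
    by (intro Bochner_Integration.integrable_add Bochner_Integration.integrable_mult_right integrable_norm_square_over_powr q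
        integrable_translate[OF wu] integrable_reflect[OF wu] integrable_weight[OF q(3), folded w_def])
  then show ?thesis
  proof (rule Bochner_Integration.integrable_bound)
    show "?f \<in> borel_measurable lborel" using u(1) by measurable
    show "AE z in lborel. norm (?f z) \<le> norm (g z)"
    proof (rule AE_I2)
      fix z :: "real^'n"
      let ?D = "u (x + z) + u (x - z) - 2 * u x"
      have nf: "norm (?f z) = \<bar>?D\<bar> * (1 / norm z powr q)" by (simp add: abs_divide q_def)
      have t1: "0 \<le> indicator (ball 0 1) z * ((norm z)\<^sup>2 / norm z powr q)" by simp
      have pos: "0 \<le> C * (indicator (ball 0 1) z * ((norm z)\<^sup>2 / norm z powr q))"
        "0 \<le> A * (\<bar>u (x + z)\<bar> * w (x + z))" "0 \<le> A * (\<bar>u (x - z)\<bar> * w (x - z))"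
        "0 \<le> A * (2 * \<bar>u x\<bar> * w z)"
        using \<open>0 \<le> C\<close> A0 w0 t1 by auto
      have "norm (?f z) \<le> g z"
      proof (cases "norm z < \<delta>")
        case True
        have "norm (?f z) \<le> C * (norm z)\<^sup>2 * (1 / norm z powr q)"
          unfolding nf using C[OF True] by (intro mult_right_mono) auto
        also have "\<dots> = C * (indicator (ball 0 1) z * ((norm z)\<^sup>2 / norm z powr q))"
          using True \<delta>(2) by simp
        finally show ?thesis using pos(2-4) unfolding g_def by linarith
      next
        case False
        have "\<bar>?D\<bar> \<le> \<bar>u (x + z)\<bar> + \<bar>u (x - z)\<bar> + 2 * \<bar>u x\<bar>" by linarith
        then have "norm (?f z) \<le> (\<bar>u (x + z)\<bar> + \<bar>u (x - z)\<bar> + 2 * \<bar>u x\<bar>) * (1 / norm z powr q)"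
          unfolding nf by (intro mult_right_mono) auto
        also have "\<dots> = \<bar>u (x + z)\<bar> * (1 / norm z powr q) + \<bar>u (x - z)\<bar> * (1 / norm z powr q)
            + 2 * \<bar>u x\<bar> * (1 / norm z powr q)" by (simp add: algebra_simps)
        also have "\<dots> \<le> \<bar>u (x + z)\<bar> * (A * w (x + z)) + \<bar>u (x - z)\<bar> * (A * w (x - z))
            + 2 * \<bar>u x\<bar> * (A * w z)"
          using False by (intro add_mono mult_left_mono far) (auto intro: norm_triangle_ineq norm_triangle_ineq4)
        finally show ?thesis using pos unfolding g_def by (simp add: algebra_simps)
      qed
      then show "norm (?f z) \<le> norm (g z)" by simp
    qed
  qed
qed

section \<open>The operators on test functions\<close>

definition admissible_kernel :: "real \<Rightarrow> real \<Rightarrow> (real^'n \<Rightarrow> real) \<Rightarrow> bool" where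
  "admissible_kernel lo hi k \<longleftrightarrow> k \<in> borel_measurable (restrict_space borel (sphere 0 1)) \<and>
     (\<forall>\<theta>\<in>sphere 0 1. lo \<le> k \<theta> \<and> k \<theta> \<le> hi)"

lemma stable_ops_kernel:
  assumes "L \<in> stable_ops s lo hi"
  obtains k where "L = stable_op s k" "admissible_kernel lo hi k"
  using assms that by (auto simp: stable_ops_def admissible_kernel_def)

lemma admissible_kernel_bounds:
  fixes z :: "real^'n"
  assumes "admissible_kernel lo hi k" "z \<noteq> 0"
  shows "lo \<le> k (z /\<^sub>R norm z)" "k (z /\<^sub>R norm z) \<le> hi"
  using assms by (auto simp: admissible_kernel_def)

text \<open>\<open>k\<close> is measurable on the sphere only, so it is first extended by 0. The
  extension changes nothing: y / |y| lies on the sphere for y \<noteq> 0, and at y = 0 the division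
  by 0 makes both sides 0.\<close>

lemma kernel_measurable:
  fixes k :: "real^'n \<Rightarrow> real"
  assumes "admissible_kernel lo hi k"
  shows "(\<lambda>y. k (y /\<^sub>R norm y) / norm y powr p) \<in> borel_measurable borel"
proof -
  have [measurable]: "(\<lambda>\<theta>. indicator (sphere 0 1) \<theta> *\<^sub>R k \<theta>) \<in> borel_measurable borel"
    using assms borel_measurable_restrict_space_iff[of "sphere 0 1" borel k]
    by (simp add: admissible_kernel_def)
  have "(\<lambda>y. k (y /\<^sub>R norm y) / norm y powr p)
      = (\<lambda>y. (\<lambda>\<theta>. indicator (sphere 0 1) \<theta> *\<^sub>R k \<theta>) (y /\<^sub>R norm y) / norm y powr p)"
  proof
    fix y :: "real^'n"
    show "k (y /\<^sub>R norm y) / norm y powr p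
      = (\<lambda>\<theta>. indicator (sphere 0 1) \<theta> *\<^sub>R k \<theta>) (y /\<^sub>R norm y) / norm y powr p"
      by (cases "y = 0") auto
  qed
  also have "\<dots> \<in> borel_measurable borel" by measurable
  finally show ?thesis .
qed

lemma stable_integrand_abs_le:
  fixes z :: "real^'n"
  assumes "admissible_kernel lo hi k" "0 < lo"
  shows "\<bar>D * (k (z /\<^sub>R norm z) / norm z powr p)\<bar> \<le> hi * \<bar>D / norm z powr p\<bar>"
proof (cases "z = 0")
  case False
  then have "\<bar>k (z /\<^sub>R norm z)\<bar> \<le> hi" using admissible_kernel_bounds[OF assms(1) False] assms(2) by simp
  then have "\<bar>k (z /\<^sub>R norm z)\<bar> * \<bar>D / norm z powr p\<bar> \<le> hi * \<bar>D / norm z powr p\<bar>"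
    by (rule mult_right_mono) simp
  then show ?thesis by (simp add: abs_mult abs_divide mult.commute)
qed simp

lemma stable_integrand_integrable:
  fixes k D :: "real^'n \<Rightarrow> real"
  assumes k: "admissible_kernel lo hi k" "0 < lo"
    and D: "integrable lborel (\<lambda>z. D z / norm z powr p)" "D \<in> borel_measurable borel"
  shows "integrable lborel (\<lambda>z. D z * (k (z /\<^sub>R norm z) / norm z powr p))"
proof (rule Bochner_Integration.integrable_bound)
  show "integrable lborel (\<lambda>z. hi * \<bar>D z / norm z powr p\<bar>)"
    using D(1) by (intro Bochner_Integration.integrable_mult_right integrable_abs)
  show "(\<lambda>z. D z * (k (z /\<^sub>R norm z) / norm z powr p)) \<in> borel_measurable lborel"
    using borel_measurable_times[OF D(2) kernel_measurable[OF k(1)]] by simp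
  show "AE z in lborel. norm (D z * (k (z /\<^sub>R norm z) / norm z powr p)) \<le> norm (hi * \<bar>D z / norm z powr p\<bar>)"
  proof (rule AE_I2)
    fix z
    have "norm (D z * (k (z /\<^sub>R norm z) / norm z powr p)) \<le> hi * \<bar>D z / norm z powr p\<bar>"
      using stable_integrand_abs_le[OF k] by simp
    also have "\<dots> \<le> norm (hi * \<bar>D z / norm z powr p\<bar>)" unfolding real_norm_def by (rule abs_ge_self)
    finally show "norm (D z * (k (z /\<^sub>R norm z) / norm z powr p)) \<le> norm (hi * \<bar>D z / norm z powr p\<bar>)" .
  qed
qed

text \<open>A real supremum dominates its members only if the family is bounded above. Here
  \<open>hi\<close> times the absolute second difference yields one bound for the whole
  class.\<close>

lemma stable_op_le_sup_op:
  fixes u :: "real^'n \<Rightarrow> real"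
  assumes L: "\<L> \<subseteq> stable_ops s lo hi" "L \<in> \<L>" and lo: "0 < lo"
    and D: "integrable lborel (\<lambda>z. (u (x + z) + u (x - z) - 2 * u x) / norm z powr (real CARD('n) + 2 * s))"
  shows "L u x \<le> sup_op \<L> u x"
proof -
  let ?B = "1/2 * (\<integral>z. hi * \<bar>(u (x + z) + u (x - z) - 2 * u x) / norm z powr (real CARD('n) + 2 * s)\<bar> \<partial>lborel)"
  have bound: "L' u x \<le> ?B" if L': "L' \<in> \<L>" for L'
  proof -
    obtain k where k: "L' = stable_op s k" "admissible_kernel lo hi k"
      by (rule stable_ops_kernel[OF subsetD[OF L(1) L']])
    show ?thesis unfolding k stable_op_def
    proof (rule mult_left_mono[OF integral_mono'])
      show "integrable lborel (\<lambda>z. hi * \<bar>(u (x + z) + u (x - z) - 2 * u x) / norm z powr (real CARD('n) + 2 * s)\<bar>)"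
        using D by (intro Bochner_Integration.integrable_mult_right integrable_abs)
      fix z
      note * = stable_integrand_abs_le[OF k(2) lo, of "u (x + z) + u (x - z) - 2 * u x" z "real CARD('n) + 2 * s"]
      show "(u (x + z) + u (x - z) - 2 * u x) * (k (z /\<^sub>R norm z) / norm z powr (real CARD('n) + 2 * s))
        \<le> hi * \<bar>(u (x + z) + u (x - z) - 2 * u x) / norm z powr (real CARD('n) + 2 * s)\<bar>"
        using order_trans[OF abs_ge_self *] .
      show "0 \<le> hi * \<bar>(u (x + z) + u (x - z) - 2 * u x) / norm z powr (real CARD('n) + 2 * s)\<bar>"
        using order_trans[OF abs_ge_zero *] .
    qed simp
  qed
  have "bdd_above ((\<lambda>L. L u x) ` \<L>)" by (rule bdd_aboveI2) (rule bound)
  then show ?thesis unfolding sup_op_def by (rule cSUP_upper[OF L(2)])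
qed

text \<open>Constants are integrable against the weight. This covers functions replaced by a test
  function on a bounded set and, with \<open>u\<close> = 0, bounded functions.\<close>

lemma L1_weighted_patch:
  fixes u v :: "real^'n \<Rightarrow> real"
  assumes s: "0 < s" and u: "L1_weighted s u" and v: "v \<in> borel_measurable borel"
    and B: "\<And>x. \<bar>v x\<bar> \<le> \<bar>u x\<bar> + B"
  shows "L1_weighted s v"
  unfolding L1_weighted_def
proof (rule Bochner_Integration.integrable_bound)
  let ?w = "\<lambda>y::real^'n. (1 + norm y) powr (- real CARD('n) - 2 * s)"
  have w: "integrable lborel ?w"
    using integrable_weight[where 'a="real^'n" and q="real CARD('n) + 2 * s"] s by simp
  have "integrable lborel (\<lambda>y. \<bar>u y\<bar> * ?w y)"
    using integrable_abs[OF u[unfolded L1_weighted_def]] by (simp add: abs_mult)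
  with w show "integrable lborel (\<lambda>y. \<bar>u y\<bar> * ?w y + B * ?w y)"
    by (intro Bochner_Integration.integrable_add Bochner_Integration.integrable_mult_right)
  show "(\<lambda>y. v y * ?w y) \<in> borel_measurable lborel" using v by measurable
  show "AE y in lborel. norm (v y * ?w y) \<le> norm (\<bar>u y\<bar> * ?w y + B * ?w y)"
  proof (rule AE_I2)
    fix y
    have "norm (v y * ?w y) = \<bar>v y\<bar> * ?w y" by (simp add: abs_mult)
    also have "\<dots> \<le> (\<bar>u y\<bar> + B) * ?w y" using B by (intro mult_right_mono) auto
    also have "\<dots> \<le> norm (\<bar>u y\<bar> * ?w y + B * ?w y)" by (simp add: algebra_simps)
    finally show "norm (v y * ?w y) \<le> norm (\<bar>u y\<bar> * ?w y + B * ?w y)" .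
  qed
qed

text \<open>Bounded second derivatives on a compact ball make the gradient Lipschitz, and the mean
  value inequality along the segment through x0 in direction z gives the quadratic bound.\<close>

lemma Ck_closure_2_second_difference:
  fixes \<phi> :: "real^'n \<Rightarrow> real"
  assumes \<phi>: "Ck_closure 2 \<phi> N" and N: "open N" "x0 \<in> N"
  obtains \<delta> C where "0 < \<delta>" "ball x0 \<delta> \<subseteq> N"
    "\<forall>z. norm z < \<delta> \<longrightarrow> \<bar>\<phi> (x0 + z) + \<phi> (x0 - z) - 2 * \<phi> x0\<bar> \<le> C * (norm z)\<^sup>2"
proof -
  obtain e where e: "0 < e" "cball x0 e \<subseteq> N" using open_contains_cball N by blast
  from \<phi> obtain G where G: "\<And>x. x \<in> N \<Longrightarrow> (\<phi> has_derivative (\<lambda>h. G x \<bullet> h)) (at x)"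
    and G1: "\<And>i. Ck_closure (Suc 0) (\<lambda>x. G x $ i) N"
    by (auto simp: numeral_2_eq_2)
  have "\<exists>B. \<forall>x\<in>cball x0 e. \<forall>y\<in>cball x0 e. \<bar>G x $ i - G y $ i\<bar> \<le> B * norm (x - y)" for i
  proof -
    from G1[of i] obtain H where H: "\<And>x. x \<in> N \<Longrightarrow> ((\<lambda>x. G x $ i) has_derivative (\<lambda>h. H x \<bullet> h)) (at x)"
      and H1: "\<And>j. continuous_on (closure N) (\<lambda>x. H x $ j)" by auto
    \<comment> \<open>\<open>H\<close> is row i of the Hessian; reassembled from its components it
      is continuous, hence bounded on the ball.\<close>
    have "continuous_on (closure N) (\<lambda>x. \<chi> j. H x $ j)"
      by (intro continuous_on_vec_lambda H1)
    then have "continuous_on (cball x0 e) H"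
      using e closure_subset by (auto intro: continuous_on_subset)
    then have "bounded (H ` cball x0 e)" by (intro compact_imp_bounded compact_continuous_image) auto
    then obtain B where B: "\<And>x. x \<in> cball x0 e \<Longrightarrow> norm (H x) \<le> B" unfolding bounded_iff by blast
    have "norm (G x $ i - G y $ i) \<le> B * norm (x - y)" if "x \<in> cball x0 e" "y \<in> cball x0 e" for x y
    proof (rule differentiable_bound[OF convex_cball _ _ that])
      fix w assume w: "w \<in> cball x0 e"
      then show "((\<lambda>x. G x $ i) has_derivative (\<lambda>h. H w \<bullet> h)) (at w within cball x0 e)"
        by (rule has_derivative_at_withinI[OF H[OF subsetD[OF e(2)]]])
      show "onorm (\<lambda>h. H w \<bullet> h) \<le> B"
      proof (rule onorm_le)
        fix h
        have "norm (H w \<bullet> h) \<le> norm (H w) * norm h" using Cauchy_Schwarz_ineq2 by auto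
        also have "\<dots> \<le> B * norm h" using B[OF w] by (intro mult_right_mono) auto
        finally show "norm (H w \<bullet> h) \<le> B * norm h" .
      qed
    qed
    then show ?thesis by (auto intro!: exI[of _ B])
  qed
  then obtain B where B: "\<And>i x y. x \<in> cball x0 e \<Longrightarrow> y \<in> cball x0 e \<Longrightarrow> \<bar>G x $ i - G y $ i\<bar> \<le> B i * norm (x - y)"
    by metis
  define K where "K = (\<Sum>i\<in>UNIV. B i)"
  have K: "norm (G x - G y) \<le> K * norm (x - y)" if "x \<in> cball x0 e" "y \<in> cball x0 e" for x y
  proof -
    have "norm (G x - G y) \<le> (\<Sum>i\<in>UNIV. \<bar>(G x - G y) $ i\<bar>)" by (rule norm_le_l1_cart)
    also have "\<dots> \<le> (\<Sum>i\<in>UNIV. B i * norm (x - y))" using B[OF that] by (intro sum_mono) simp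
    finally show ?thesis by (simp add: K_def sum_distrib_right)
  qed
  have "\<bar>\<phi> (x0 + z) + \<phi> (x0 - z) - 2 * \<phi> x0\<bar> \<le> (2 * K) * (norm z)\<^sup>2" if z: "norm z < e" for z
  proof -
    \<comment> \<open>\<open>h 1 - h 0\<close> is the second difference. Its derivative compares
      gradients at points 2 t |z| apart and multiplies by z, whence two powers of |z|.\<close>
    define h where "h t = \<phi> (x0 + t *\<^sub>R z) + \<phi> (x0 - t *\<^sub>R z)" for t :: real
    define h' where "h' t = G (x0 + t *\<^sub>R z) \<bullet> z - G (x0 - t *\<^sub>R z) \<bullet> z" for t :: real
    have inb: "x0 + t *\<^sub>R z \<in> cball x0 e" "x0 - t *\<^sub>R z \<in> cball x0 e" if "t \<in> {0..1}" for t
    proof -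
      have "t * norm z \<le> 1 * norm z" using that by (intro mult_right_mono) auto
      then show "x0 + t *\<^sub>R z \<in> cball x0 e" "x0 - t *\<^sub>R z \<in> cball x0 e"
        using that z by (auto simp: dist_norm)
    qed
    have d: "(h has_derivative (\<lambda>r. h' t * r)) (at t within {0..1})" if t: "t \<in> {0..1}" for t
    proof -
      have 1: "((\<lambda>t. \<phi> (x0 + t *\<^sub>R z)) has_derivative (\<lambda>r. G (x0 + t *\<^sub>R z) \<bullet> (r *\<^sub>R z))) (at t within {0..1})"
        by (rule has_derivative_compose[OF _ G]) (use inb[OF t] e in \<open>auto intro!: derivative_eq_intros\<close>)
      have 2: "((\<lambda>t. \<phi> (x0 - t *\<^sub>R z)) has_derivative (\<lambda>r. G (x0 - t *\<^sub>R z) \<bullet> (- (r *\<^sub>R z)))) (at t within {0..1})"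
        by (rule has_derivative_compose[OF _ G]) (use inb[OF t] e in \<open>auto intro!: derivative_eq_intros\<close>)
      show ?thesis using has_derivative_add[OF 1 2] unfolding h_def h'_def
        by (simp add: algebra_simps)
    qed
    have b: "onorm (\<lambda>r. h' t * r) \<le> 2 * K * (norm z)\<^sup>2" if t: "t \<in> {0..1}" for t
    proof (rule onorm_le)
      fix r
      have "\<bar>h' t\<bar> = \<bar>(G (x0 + t *\<^sub>R z) - G (x0 - t *\<^sub>R z)) \<bullet> z\<bar>" by (simp add: h'_def inner_diff_left)
      also have "\<dots> \<le> norm (G (x0 + t *\<^sub>R z) - G (x0 - t *\<^sub>R z)) * norm z" by (rule Cauchy_Schwarz_ineq2)
      also have "\<dots> \<le> (K * norm ((x0 + t *\<^sub>R z) - (x0 - t *\<^sub>R z))) * norm z"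
        by (intro mult_right_mono K inb[OF t] norm_ge_zero)
      also have "(x0 + t *\<^sub>R z) - (x0 - t *\<^sub>R z) = (2 * t) *\<^sub>R z" by (simp add: vec_eq_iff)
      also have "(K * norm ((2 * t) *\<^sub>R z)) * norm z = t * (2 * K * (norm z)\<^sup>2)"
        using t by (simp add: power2_eq_square)
      also have "\<dots> \<le> 1 * (2 * K * (norm z)\<^sup>2)"
      proof (rule mult_right_mono)
        have "0 \<le> K * norm z" using order_trans[OF norm_ge_zero K[of "x0 + z" x0]] z inb[of 1] e by simp
        then have "0 \<le> (K * norm z) * norm z" by (rule mult_nonneg_nonneg) simp
        then show "0 \<le> 2 * K * (norm z)\<^sup>2" by (simp add: power2_eq_square algebra_simps)
      qed (use t in simp)
      finally show "norm (h' t * r) \<le> 2 * K * (norm z)\<^sup>2 * norm r"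
        by (simp add: abs_mult mult_right_mono)
    qed
    have "norm (h 1 - h 0) \<le> 2 * K * (norm z)\<^sup>2 * norm (1 - 0 :: real)"
      by (rule differentiable_bound[OF convex_real_interval(5) d b]) auto
    then show ?thesis by (simp add: h_def)
  qed
  moreover have "ball x0 e \<subseteq> N" using e(2) ball_subset_cball by blast
  ultimately show thesis using that[of e "2 * K"] e(1) by simp
qed

lemma measurable_patch:
  fixes \<phi> u :: "real^'n \<Rightarrow> real"
  assumes "open N" "continuous_on N \<phi>" "continuous_on UNIV u"
  shows "(\<lambda>x. if x \<in> N then \<phi> x else u x) \<in> borel_measurable borel"
  using assms continuous_on_subset[OF assms(3) subset_UNIV]
  by (intro borel_measurable_continuous_on_if) auto

text \<open>On the compact closure of \<open>N\<close> the test function is bounded, so the patch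
  stays in the weighted space; near x0 it equals \<phi>, which supplies the quadratic bound.\<close>

lemma patched_second_difference_integrable:
  fixes \<phi> u :: "real^'n \<Rightarrow> real"
  assumes s: "0 < s" "s < 1" and u: "continuous_on UNIV u" "L1_weighted s u"
    and N: "open N" "bounded N" "x0 \<in> N" and \<phi>: "Ck_closure 2 \<phi> N"
  defines "v \<equiv> \<lambda>x. if x \<in> N then \<phi> x else u x"
  shows "v \<in> borel_measurable borel"
    and "integrable lborel (\<lambda>z. (v (x0 + z) + v (x0 - z) - 2 * v x0) / norm z powr (real CARD('n) + 2 * s))"
proof -
  have c: "continuous_on (closure N) \<phi>" using \<phi> by (simp add: numeral_2_eq_2)
  show v: "v \<in> borel_measurable borel" unfolding v_def
    by (rule measurable_patch[OF N(1) continuous_on_subset[OF c closure_subset] u(1)])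
  have "bounded (\<phi> ` closure N)"
    using N c by (intro compact_imp_bounded compact_continuous_image) (auto simp: compact_closure)
  then obtain B where "\<And>x. x \<in> closure N \<Longrightarrow> \<bar>\<phi> x\<bar> \<le> B" by (auto simp: bounded_iff)
  then have B: "\<bar>\<phi> x\<bar> \<le> B" if "x \<in> N" for x using that closure_subset by blast
  have "0 \<le> B" using B[OF N(3)] by linarith
  have L: "L1_weighted s v"
  proof (rule L1_weighted_patch[OF s(1) u(2) v])
    show "\<bar>v x\<bar> \<le> \<bar>u x\<bar> + B" for x using B[of x] \<open>0 \<le> B\<close> by (auto simp: v_def)
  qed
  obtain \<delta> C where d: "0 < \<delta>" "ball x0 \<delta> \<subseteq> N"
    "\<forall>z. norm z < \<delta> \<longrightarrow> \<bar>\<phi> (x0 + z) + \<phi> (x0 - z) - 2 * \<phi> x0\<bar> \<le> C * (norm z)\<^sup>2"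
    using Ck_closure_2_second_difference[OF \<phi> N(1,3)] by blast
  show "integrable lborel (\<lambda>z. (v (x0 + z) + v (x0 - z) - 2 * v x0) / norm z powr (real CARD('n) + 2 * s))"
  proof (rule second_difference_integrable[OF s v L d(1)])
    fix z :: "real^'n" assume z: "norm z < \<delta>"
    then have "x0 + z \<in> N" "x0 - z \<in> N" using d(2) by (auto simp: subset_iff dist_norm)
    then show "\<bar>v (x0 + z) + v (x0 - z) - 2 * v x0\<bar> \<le> C * (norm z)\<^sup>2"
      using d(3) z N by (simp add: v_def)
  qed
qed

text \<open>Two centres are provided because the test functions of the doubling argument carry a
  penalty centred at the partner point and a term centred at the contact point that makes the
  contact strict.\<close>

lemma Ck_closure_2_quadratic:
  fixes p r :: "real^'n"
  shows "Ck_closure 2 (\<lambda>x. A + B * (norm (x - p))\<^sup>2 + C * (norm (x - r))\<^sup>2) N"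
proof -
  let ?G = "\<lambda>x. (2 * B) *\<^sub>R (x - p) + (2 * C) *\<^sub>R (x - r)"
  have d1: "((\<lambda>x. A + B * (norm (x - p))\<^sup>2 + C * (norm (x - r))\<^sup>2) has_derivative (\<lambda>h. ?G x \<bullet> h)) (at x)" for x
    unfolding power2_norm_eq_inner
    by (auto intro!: derivative_eq_intros simp: algebra_simps inner_commute inner_diff_left inner_diff_right inner_add_left)
  \<comment> \<open>The Hessian is 2 B + 2 C times the identity; the axis vector is its row
    i.\<close>
  have d2: "((\<lambda>x. ?G x $ i) has_derivative (\<lambda>h. axis i (2 * B + 2 * C) \<bullet> h)) (at x)" for x i
    unfolding inner_axis'
    by (auto intro!: derivative_eq_intros bounded_linear.has_derivative[OF bounded_linear_vec_nth] simp: algebra_simps)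
  have d3: "Ck_closure (Suc 0) (\<lambda>x. ?G x $ i) N" for i
    using d2[of i] by (auto intro!: exI[of _ "\<lambda>_. axis i (2 * B + 2 * C)"] continuous_intros)
  have "Ck_closure (Suc (Suc 0)) (\<lambda>x. A + B * (norm (x - p))\<^sup>2 + C * (norm (x - r))\<^sup>2) N"
    unfolding Ck_closure.simps(2)[of "Suc 0"]
    by (intro conjI exI[of _ ?G] ballI allI d1 d3) (intro continuous_intros)
  then show ?thesis by (simp only: numeral_2_eq_2)
qed

text \<open>The parallelogram law. The value is independent of x and p, so both quadratic terms of a
  test function add up.\<close>

lemma norm_square_second_difference:
  fixes x p z :: "'a::real_inner"
  shows "(norm (x + z - p))\<^sup>2 + (norm (x - z - p))\<^sup>2 - 2 * (norm (x - p))\<^sup>2 = 2 * (norm z)\<^sup>2"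
  by (simp add: power2_norm_eq_inner algebra_simps inner_commute)

text \<open>Dominated convergence with the integrand on the unit ball as majorant: each z \<noteq> 0
  eventually leaves the balls, and at z = 0 the integrand is 0.\<close>

lemma small_ball_integral_tendsto_0:
  fixes q :: real
  assumes q: "0 \<le> q" "q < DIM('a::euclidean_space) + 2"
  shows "(\<lambda>n. \<integral>z. indicator (ball (0::'a) (1 / real (Suc n))) z * ((norm z)\<^sup>2 / norm z powr q) \<partial>lborel) \<longlonglongrightarrow> 0"
proof -
  let ?f = "\<lambda>z::'a. indicator (ball 0 1) z * ((norm z)\<^sup>2 / norm z powr q)"
  let ?s = "\<lambda>n z::'a. indicator (ball 0 (1 / real (Suc n))) z * ((norm z)\<^sup>2 / norm z powr q)"
  have i: "integrable lborel ?f" by (rule integrable_norm_square_over_powr[OF q])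
  have "(\<lambda>n. integral\<^sup>L lborel (?s n)) \<longlonglongrightarrow> integral\<^sup>L lborel (\<lambda>_::'a. 0::real)"
  proof (rule integral_dominated_convergence[OF _ _ i])
    show "?s n \<in> borel_measurable lborel" for n
      by (intro borel_measurable_times borel_measurable_indicator borel_measurable_divide
        borel_measurable_power powr_real_measurable) auto
    show "AE z in lborel. norm (?s n z) \<le> ?f z" for n
    proof (rule AE_I2)
      fix z :: 'a
      have "1 / real (Suc n) \<le> 1" by simp
      then have "ball (0::'a) (1 / real (Suc n)) \<subseteq> ball 0 1" by (rule subset_ball)
      then show "norm (?s n z) \<le> ?f z" by (auto simp: indicator_def)
    qed
    show "AE z in lborel. (\<lambda>n. ?s n z) \<longlonglongrightarrow> 0"
    proof (rule AE_I2)
      fix z :: 'a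
      show "(\<lambda>n. ?s n z) \<longlonglongrightarrow> 0"
      proof (cases "z = 0")
        case False
        obtain m where m: "1 / real (Suc m) < norm z" using False
          by (metis nat_approx_posE zero_less_norm_iff)
        have "?s n z = 0" if "m \<le> n" for n
        proof -
          have "1 / real (Suc n) \<le> 1 / real (Suc m)" using that by (intro divide_left_mono) auto
          then show ?thesis using m by (auto simp: indicator_def)
        qed
        then show ?thesis by (intro tendsto_eventually) (auto simp: eventually_sequentially)
      qed simp
    qed
  qed simp
  then show ?thesis by simp
qed

section \<open>Doubling of variables\<close>

text \<open>
  The comparison at a maximum of the doubled functional. On a small ball both test functions are
  quadratic and contribute an error that vanishes with the radius; outside it the second
  differences of \<open>u\<close> and \<open>v\<close> compare with a favourable sign, and with gap \<open>2 * M\<close> on \<open>S\<close>.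
\<close>

lemma doubling_comparison:
  fixes u v :: "real^'n \<Rightarrow> real"
  assumes s: "0 < s" "s < 1" and lo: "0 < lo"
    and \<L>: "\<L> \<subseteq> stable_ops s lo hi" "L \<in> \<L>"
    and u: "continuous_on UNIV u" "L1_weighted s u" "visc_ge L \<Omega> u f"
    and v: "continuous_on UNIV v" "L1_weighted s v" "visc_le (sup_op \<L>) \<Omega> v g"
    and \<Omega>: "open \<Omega>" "x0 \<in> \<Omega>" "y0 \<in> \<Omega>"
    and a: "0 \<le> a"
    and max: "\<And>x y. u x - v y - a * (norm (x - y))\<^sup>2 \<le> u x0 - v y0 - a * (norm (x0 - y0))\<^sup>2"
    and S: "S \<in> sets borel" "\<And>z. z \<in> S \<Longrightarrow> \<delta>0 \<le> norm z \<and> norm z \<le> R" and \<delta>0: "0 < \<delta>0"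
    and M: "0 \<le> M" "\<And>z. z \<in> S \<Longrightarrow>
        (u (x0 + z) - v (y0 + z)) + (u (x0 - z) - v (y0 - z)) \<le> 2 * (u x0 - v y0) - 2 * M"
  shows "f x0 - g y0 \<le> - (M * lo / R powr (real CARD('n) + 2 * s) * measure lborel S)"
proof -
  define q where "q = real CARD('n) + 2 * s"
  have q: "0 \<le> q" "q < DIM(real^'n) + 2" using s by (auto simp: q_def)
  obtain k where k: "L = stable_op s k" "admissible_kernel lo hi k"
    by (rule stable_ops_kernel[OF subsetD[OF \<L>]])
  have hi: "0 \<le> hi"
  proof -
    have "axis (undefined::'n) (1::real) \<in> sphere 0 1" by simp
    then have "lo \<le> k (axis undefined 1) \<and> k (axis undefined 1) \<le> hi"
      using k(2) unfolding admissible_kernel_def by blast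
    then show ?thesis using lo by linarith
  qed
  obtain d1 where d1: "0 < d1" "ball x0 d1 \<subseteq> \<Omega>" using \<Omega> open_contains_ball by blast
  obtain d2 where d2: "0 < d2" "ball y0 d2 \<subseteq> \<Omega>" using \<Omega> open_contains_ball by blast
  \<comment> \<open>Balls of radius at most \<open>dm\<close> stay inside \<Omega> around both
    points, and around 0 they miss \<open>S\<close>.\<close>
  define dm where "dm = min \<delta>0 (min d1 d2)"
  have dm: "0 < dm" using \<delta>0 d1 d2 by (auto simp: dm_def)
  \<comment> \<open>Freezing y = y0 in \<open>max\<close> bounds \<open>u\<close> from above by a
    paraboloid that touches it at x0, and freezing x = x0 bounds \<open>v\<close> from below at y0.
    The terms with coefficients 1 and -1 make the contacts strict.\<close>
  define \<phi> where "\<phi> = (\<lambda>x. (u x0 - a * (norm (x0 - y0))\<^sup>2) + a * (norm (x - y0))\<^sup>2 + 1 * (norm (x - x0))\<^sup>2)"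
  define \<zeta> where "\<zeta> = (\<lambda>y. (v y0 + a * (norm (x0 - y0))\<^sup>2) + (- a) * (norm (y - x0))\<^sup>2 + (- 1) * (norm (y - y0))\<^sup>2)"
  have \<phi>C: "Ck_closure 2 \<phi> N" and \<zeta>C: "Ck_closure 2 \<zeta> N" for N
    unfolding \<phi>_def \<zeta>_def by (rule Ck_closure_2_quadratic)+
  have \<phi>0: "\<phi> x0 = u x0" and \<zeta>0: "\<zeta> y0 = v y0" by (auto simp: \<phi>_def \<zeta>_def norm_minus_commute)
  have \<phi>u: "u x < \<phi> x" if "x \<noteq> x0" for x
  proof -
    have "0 < (norm (x - x0))\<^sup>2" using that by simp
    then show ?thesis using max[of x y0] unfolding \<phi>_def by linarith
  qed
  have \<zeta>v: "\<zeta> y < v y" if "y \<noteq> y0" for y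
  proof -
    have "0 < (norm (y - y0))\<^sup>2" using that by simp
    then show ?thesis using max[of x0 y] unfolding \<zeta>_def norm_minus_commute[of x0 y] by linarith
  qed
  let ?I = "\<lambda>\<delta>. \<integral>z. indicator (ball (0::real^'n) \<delta>) z * ((norm z)\<^sup>2 / norm z powr q) \<partial>lborel"
  have main: "f x0 - g y0 + M * lo / R powr q * measure lborel S \<le> 2 * (a + 1) * hi * ?I \<delta>"
    if \<delta>: "0 < \<delta>" "\<delta> \<le> dm" "\<delta> \<le> 1" for \<delta>
  proof -
    let ?N = "ball x0 \<delta>" and ?N' = "ball y0 \<delta>"
    define U where "U = (\<lambda>x. if x \<in> ?N then \<phi> x else u x)"
    define V where "V = (\<lambda>x. if x \<in> ?N' then \<zeta> x else v x)"
    have "?N \<subseteq> ball x0 d1" "?N' \<subseteq> ball y0 d2" using \<delta> by (auto simp: dm_def)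
    then have N: "?N \<subseteq> \<Omega>" "?N' \<subseteq> \<Omega>" using d1 d2 by auto
    have fU: "f x0 \<le> L U x0"
      unfolding U_def using N(1) \<phi>C[of ?N] \<phi>0 \<phi>u \<delta>
      by (intro u(3)[unfolded visc_ge_def, rule_format, OF \<Omega>(2)]) simp
    have gV: "sup_op \<L> V y0 \<le> g y0"
      unfolding V_def using N(2) \<zeta>C[of ?N'] \<zeta>0 \<zeta>v \<delta>
      by (intro v(3)[unfolded visc_le_def, rule_format, OF \<Omega>(3)]) simp
    define DU where "DU = (\<lambda>z. U (x0 + z) + U (x0 - z) - 2 * U x0)"
    define DV where "DV = (\<lambda>z. V (y0 + z) + V (y0 - z) - 2 * V y0)"
    have U: "U \<in> borel_measurable borel" "integrable lborel (\<lambda>z. DU z / norm z powr q)"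
      unfolding U_def DU_def q_def
      using patched_second_difference_integrable[OF s u(1,2) open_ball bounded_ball _ \<phi>C[of ?N], of x0] \<delta>
      by simp_all
    have V: "V \<in> borel_measurable borel" "integrable lborel (\<lambda>z. DV z / norm z powr q)"
      unfolding V_def DV_def q_def
      using patched_second_difference_integrable[OF s v(1,2) open_ball bounded_ball _ \<zeta>C[of ?N'], of y0] \<delta>
      by simp_all
    \<comment> \<open>A supersolution for the supremum is one for \<open>L\<close>, so both
      inequalities now have the same kernel and can be subtracted.\<close>
    have gV': "L V y0 \<le> g y0"
      using stable_op_le_sup_op[OF \<L> lo, of V y0] V(2) gV unfolding DV_def q_def by simp
    let ?\<kappa> = "\<lambda>z. k (z /\<^sub>R norm z) / norm z powr q"
    have iU: "integrable lborel (\<lambda>z. DU z * ?\<kappa> z)"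
      by (rule stable_integrand_integrable[OF k(2) lo U(2)]) (use U(1) in \<open>simp add: DU_def\<close>)
    have iV: "integrable lborel (\<lambda>z. DV z * ?\<kappa> z)"
      by (rule stable_integrand_integrable[OF k(2) lo V(2)]) (use V(1) in \<open>simp add: DV_def\<close>)
    have LU: "L U x0 = 1/2 * (\<integral>z. DU z * ?\<kappa> z \<partial>lborel)"
      and LV: "L V y0 = 1/2 * (\<integral>z. DV z * ?\<kappa> z \<partial>lborel)"
      by (simp_all add: k stable_op_def DU_def DV_def q_def)
    have diff: "L U x0 - L V y0 = 1/2 * (\<integral>z. (DU z - DV z) * ?\<kappa> z \<partial>lborel)"
      unfolding LU LV left_diff_distrib Bochner_Integration.integral_diff[OF iU iV]
      by (simp only: right_diff_distrib)
    have Sball: "S \<subseteq> cball 0 R" using S(2) by auto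
    have Sfin: "emeasure lborel S < \<infinity>"
      by (rule order_le_less_trans[OF emeasure_mono[OF Sball] emeasure_lborel_cball_finite]) simp
    \<comment> \<open>The majorant: on the small ball the second differences of \<phi> and \<zeta>
      are 2 (a + 1) |z|^2 and its negative, with kernel at most \<open>hi\<close>; on
      \<open>S\<close> the gap 2 \<open>M\<close> meets a kernel of at least \<open>lo\<close> /
      R^q.\<close>
    let ?h = "\<lambda>z::real^'n. 4 * (a + 1) * hi * (indicator (ball 0 \<delta>) z * ((norm z)\<^sup>2 / norm z powr q))
        - 2 * M * lo / R powr q * indicator S z"
    have i1: "integrable lborel (\<lambda>z::real^'n. indicator (ball 0 \<delta>) z * ((norm z)\<^sup>2 / norm z powr q))"
    proof (rule Bochner_Integration.integrable_bound[OF integrable_norm_square_over_powr[OF q]])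
      show "(\<lambda>z::real^'n. indicator (ball 0 \<delta>) z * ((norm z)\<^sup>2 / norm z powr q)) \<in> borel_measurable lborel"
        by (intro borel_measurable_times borel_measurable_indicator borel_measurable_divide
          borel_measurable_power powr_real_measurable) auto
    qed (use \<delta> in \<open>auto simp: indicator_def\<close>)
    have i2: "integrable lborel (indicator S :: real^'n \<Rightarrow> real)"
      using S(1) Sfin by (simp add: integrable_indicator_iff)
    have "(\<integral>z. (DU z - DV z) * ?\<kappa> z \<partial>lborel) \<le> (\<integral>z. ?h z \<partial>lborel)"
    proof (rule integral_mono)
      show "integrable lborel (\<lambda>z. (DU z - DV z) * ?\<kappa> z)"
        unfolding left_diff_distrib by (rule Bochner_Integration.integrable_diff[OF iU iV])
      show "integrable lborel ?h"
        by (intro Bochner_Integration.integrable_diff Bochner_Integration.integrable_mult_right i1 i2)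
      fix z :: "real^'n"
      show "(DU z - DV z) * ?\<kappa> z \<le> ?h z"
      proof (cases "z = 0")
        case True
        then show ?thesis using S(2)[of 0] \<delta>0 by (auto simp: indicator_def)
      next
        case z: False
        have kb: "lo \<le> k (z /\<^sub>R norm z)" "k (z /\<^sub>R norm z) \<le> hi"
          using admissible_kernel_bounds[OF k(2) z] .
        have pz: "0 < norm z powr q" using z by simp
        show ?thesis
        proof (cases "norm z < \<delta>")
          case True
          then have "z \<notin> S" using S(2) \<delta>(2) by (force simp: dm_def)
          have "DU z = 2 * (a + 1) * (norm z)\<^sup>2" "DV z = - 2 * (a + 1) * (norm z)\<^sup>2"
            using True \<delta> norm_square_second_difference[of x0 z y0] norm_square_second_difference[of x0 z x0]
             norm_square_second_difference[of y0 z y0] norm_square_second_difference[of y0 z x0]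
            unfolding DU_def DV_def U_def V_def \<phi>_def \<zeta>_def
            by (simp_all add: dist_norm) (algebra+)
          then have "DU z - DV z = 4 * (a + 1) * (norm z)\<^sup>2" by algebra
          then have "(DU z - DV z) * ?\<kappa> z = 4 * (a + 1) * ((norm z)\<^sup>2 / norm z powr q) * k (z /\<^sub>R norm z)"
            by simp
          also have "\<dots> \<le> 4 * (a + 1) * ((norm z)\<^sup>2 / norm z powr q) * hi"
            using a kb by (intro mult_left_mono) auto
          also have "\<dots> = ?h z" using True \<open>z \<notin> S\<close> by simp
          finally show ?thesis .
        next
          case False
          then have D: "DU z - DV z = (u (x0 + z) - v (y0 + z)) + (u (x0 - z) - v (y0 - z)) - 2 * (u x0 - v y0)"
            using \<delta>(1) \<phi>0 \<zeta>0 by (simp add: DU_def DV_def U_def V_def dist_norm)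
          have \<kappa>0: "0 \<le> ?\<kappa> z" using kb lo pz by simp
          show ?thesis
          proof (cases "z \<in> S")
            case True
            have R: "0 < R" "norm z \<le> R" using S(2)[OF True] \<delta>0 by auto
            have "lo / R powr q \<le> ?\<kappa> z"
              using kb lo pz R q by (intro frac_le powr_mono2) auto
            then have "2 * M * (lo / R powr q) \<le> 2 * M * ?\<kappa> z" using M(1) by (intro mult_left_mono) auto
            moreover have "(DU z - DV z) * ?\<kappa> z \<le> (- 2 * M) * ?\<kappa> z"
              using D M(2)[OF True] \<kappa>0 by (intro mult_right_mono) auto
            ultimately show ?thesis using False True by simp
          next
            case nS: False
            \<comment> \<open>A common shift of both points leaves the penalty unchanged, so
              \<open>max\<close> applies at the pairs shifted by z and by -z.\<close>
            have "DU z - DV z \<le> 0"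
              using D max[of "x0 + z" "y0 + z"] max[of "x0 - z" "y0 - z"] by simp
            from mult_nonpos_nonneg[OF this \<kappa>0] show ?thesis using False nS by simp
          qed
        qed
      qed
    qed
    also have "\<dots> = 4 * (a + 1) * hi * ?I \<delta> - 2 * M * lo / R powr q * measure lborel S"
      using S(1) unfolding Bochner_Integration.integral_diff[OF
          Bochner_Integration.integrable_mult_right[OF i1] Bochner_Integration.integrable_mult_right[OF i2]]
        integral_mult_right_zero by simp
    finally have "L U x0 - L V y0 \<le>
        1/2 * (4 * (a + 1) * hi * ?I \<delta> - 2 * M * lo / R powr q * measure lborel S)"
      unfolding diff by (rule mult_left_mono) simp
    also have "\<dots> = 2 * (a + 1) * hi * ?I \<delta> - M * lo / R powr q * measure lborel S"
      by (simp add: algebra_simps)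
    finally show ?thesis using fU gV' by linarith
  qed
  \<comment> \<open>The penalty coefficient \<open>a\<close> is fixed while the radius tends to 0,
    so the error vanishes.\<close>
  have "(\<lambda>n. 2 * (a + 1) * hi * ?I (1 / real (Suc n))) \<longlonglongrightarrow> 2 * (a + 1) * hi * 0"
    by (intro tendsto_mult_left small_ball_integral_tendsto_0[OF q])
  moreover obtain m where m: "1 / real (Suc m) < dm" using dm by (metis nat_approx_posE)
  have "\<exists>m. \<forall>n\<ge>m. f x0 - g y0 + M * lo / R powr q * measure lborel S \<le> 2 * (a + 1) * hi * ?I (1 / real (Suc n))"
  proof (intro exI[of _ m] allI impI main)
    fix n assume "m \<le> n"
    then have "1 / real (Suc n) \<le> 1 / real (Suc m)" by (intro divide_left_mono) auto
    then show "1 / real (Suc n) \<le> dm" using m by simp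
  qed auto
  ultimately have "f x0 - g y0 + M * lo / R powr q * measure lborel S \<le> 2 * (a + 1) * hi * 0"
    by (rule LIMSEQ_le_const)
  then show ?thesis by (simp add: q_def)
qed

text \<open>A positive maximum of the penalised functional is attained although \<open>v\<close>
  lives on the whole space: \<open>u\<close> confines x to the closure of \<Omega>, and the penalty
  confines y. Along a subsequence both points merge, and continuity preserves the positive
  gap.\<close>

lemma doubling_sequence:
  fixes u v :: "'a::euclidean_space \<Rightarrow> real"
  assumes \<Omega>: "bounded \<Omega>" and u: "continuous_on UNIV u" "\<And>x. x \<notin> \<Omega> \<Longrightarrow> u x = 0"
    and v: "continuous_on UNIV v" "\<And>x. 0 \<le> v x" and p: "v p < u p"
  obtains a :: "nat \<Rightarrow> real" and X Y :: "nat \<Rightarrow> 'a" and x0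
  where "\<forall>n. 0 \<le> a n"
    "\<forall>n x y. u x - v y - a n * (norm (x - y))\<^sup>2 \<le> u (X n) - v (Y n) - a n * (norm (X n - Y n))\<^sup>2"
    "X \<longlonglongrightarrow> x0" "Y \<longlonglongrightarrow> x0" "v x0 < u x0"
proof -
  have D: "compact (closure \<Omega>)" using \<Omega> by (simp add: compact_closure)
  then have "bounded (u ` closure \<Omega>)"
    using u(1) by (intro compact_imp_bounded compact_continuous_image) (auto intro: continuous_on_subset)
  then obtain B where B: "\<forall>x\<in>closure \<Omega>. \<bar>u x\<bar> \<le> B" by (auto simp: bounded_iff)
  have p\<Omega>: "p \<in> \<Omega>" using p u(2)[of p] v(2)[of p] by force
  then have p': "p \<in> closure \<Omega>" using closure_subset by blast
  have B0: "0 \<le> B" using B p' by force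
  have uB: "u x \<le> B" for x
    using B u(2)[of x] B0 closure_subset[of \<Omega>] by (cases "x \<in> \<Omega>") force+
  obtain \<rho> where \<rho>: "\<forall>x\<in>closure \<Omega>. norm x \<le> \<rho>" using compact_imp_bounded[OF D] by (auto simp: bounded_iff)
  \<comment> \<open>If x is in the closure and y outside this ball, then |x - y| \<ge> B + 1, so the
    penalty is at least (B + 1)^2 and exceeds \<open>u\<close> x. If x is outside the closure,
    \<open>u\<close> x = 0. Either way the functional is at most 0, below its value at (p,
    p).\<close>
  let ?C = "closure \<Omega> \<times> cball (0::'a) (\<rho> + B + 1)"
  have compC: "compact ?C" by (intro compact_Times D compact_cball)
  have pC: "(p, p) \<in> ?C" using p' \<rho> B0 by force
  have "\<exists>z. \<forall>x y. u x - v y - real (Suc n) * (norm (x - y))\<^sup>2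
      \<le> u (fst z) - v (snd z) - real (Suc n) * (norm (fst z - snd z))\<^sup>2" for n
  proof -
    let ?\<Phi> = "\<lambda>z. u (fst z) - v (snd z) - real (Suc n) * (norm (fst z - snd z))\<^sup>2"
    have "continuous_on ?C ?\<Phi>"
      by (intro continuous_intros continuous_on_compose2[OF u(1)] continuous_on_compose2[OF v(1)]) auto
    then obtain z where z: "z \<in> ?C" "\<And>w. w \<in> ?C \<Longrightarrow> ?\<Phi> w \<le> ?\<Phi> z"
      using continuous_attains_sup[OF compC, of ?\<Phi>] pC by blast
    have pos: "0 < ?\<Phi> z" using z(2)[OF pC] p by simp
    have "u x - v y - real (Suc n) * (norm (x - y))\<^sup>2 \<le> ?\<Phi> z" for x y
    proof (cases "(x, y) \<in> ?C")
      case True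
      then show ?thesis using z(2)[of "(x, y)"] by simp
    next
      case False
      have "u x \<le> real (Suc n) * (norm (x - y))\<^sup>2"
      proof (cases "x \<in> closure \<Omega>")
        case True
        then have "\<rho> + B + 1 < norm y" "norm x \<le> \<rho>" using False \<rho> by auto
        then have "B + 1 \<le> norm (x - y)" using norm_triangle_ineq2[of y x] by (simp add: norm_minus_commute)
        then have "(B + 1) * (B + 1) \<le> (norm (x - y))\<^sup>2" using B0 unfolding power2_eq_square by (intro mult_mono) auto
        moreover have "B \<le> (B + 1) * (B + 1)" using B0 by (simp add: algebra_simps)
        moreover have "1 * (norm (x - y))\<^sup>2 \<le> real (Suc n) * (norm (x - y))\<^sup>2"
          by (intro mult_right_mono) auto
        ultimately show ?thesis using uB[of x] by linarith
      next
        case False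
        then have "u x = 0" using u(2) closure_subset by blast
        then show ?thesis by simp
      qed
      then show ?thesis using pos v(2)[of y] by linarith
    qed
    then show ?thesis by blast
  qed
  then obtain Z where Z: "\<And>n x y. u x - v y - real (Suc n) * (norm (x - y))\<^sup>2
      \<le> u (fst (Z n)) - v (snd (Z n)) - real (Suc n) * (norm (fst (Z n) - snd (Z n)))\<^sup>2"
    by metis
  define X where "X n = fst (Z n)" for n
  define Y where "Y n = snd (Z n)" for n
  have max: "u x - v y - real (Suc n) * (norm (x - y))\<^sup>2
      \<le> u (X n) - v (Y n) - real (Suc n) * (norm (X n - Y n))\<^sup>2" for n x y
    using Z by (simp add: X_def Y_def)
  have low: "u p - v p \<le> u (X n) - v (Y n) - real (Suc n) * (norm (X n - Y n))\<^sup>2" for n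
    using max[of p p n] by simp
  have "X n \<in> closure \<Omega>" for n
  proof -
    have "0 < u (X n)"
    proof -
      have "0 \<le> real (Suc n) * (norm (X n - Y n))\<^sup>2" by simp
      then show ?thesis using low[of n] p v(2)[of "Y n"] by linarith
    qed
    then show ?thesis using u(2)[of "X n"] closure_subset[of \<Omega>] by force
  qed
  then obtain x0 r where r: "strict_mono r" "(X \<circ> r) \<longlonglongrightarrow> x0"
    using D unfolding compact_def by metis
  \<comment> \<open>The maximal value is positive, \<open>v\<close> is nonnegative and
    \<open>u\<close> is at most \<open>B\<close>, so the whole penalty is at most
    \<open>B\<close>.\<close>
  have "(\<lambda>n. (norm (X n - Y n))\<^sup>2) \<longlonglongrightarrow> 0"
  proof (rule tendsto_sandwich[of "\<lambda>_. 0" _ _ "\<lambda>n. B / real (Suc n)"])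
    have "(norm (X n - Y n))\<^sup>2 \<le> B / real (Suc n)" for n
    proof -
      have "real (Suc n) * (norm (X n - Y n))\<^sup>2 \<le> B"
        using low[of n] p v(2)[of "Y n"] uB[of "X n"] by linarith
      then show ?thesis by (simp add: field_simps)
    qed
    then show "\<forall>\<^sub>F n in sequentially. (norm (X n - Y n))\<^sup>2 \<le> B / real (Suc n)" by simp
    show "(\<lambda>n. B / real (Suc n)) \<longlonglongrightarrow> 0"
      by (rule LIMSEQ_Suc[OF lim_const_over_n])
  qed auto
  then have "(\<lambda>n. sqrt ((norm (X n - Y n))\<^sup>2)) \<longlonglongrightarrow> sqrt 0" by (rule tendsto_real_sqrt)
  then have "(\<lambda>n. X n - Y n) \<longlonglongrightarrow> 0" by (simp add: tendsto_norm_zero_iff)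
  then have "((\<lambda>n. X n - Y n) \<circ> r) \<longlonglongrightarrow> 0" by (rule LIMSEQ_subseq_LIMSEQ[OF _ r(1)])
  then have "(\<lambda>n. (X \<circ> r) n - ((\<lambda>n. X n - Y n) \<circ> r) n) \<longlonglongrightarrow> x0 - 0" using r(2) by (intro tendsto_diff)
  then have Yr: "(Y \<circ> r) \<longlonglongrightarrow> x0" by (simp add: comp_def)
  have cu: "(\<lambda>n. u ((X \<circ> r) n)) \<longlonglongrightarrow> u x0" and cv: "(\<lambda>n. v ((Y \<circ> r) n)) \<longlonglongrightarrow> v x0"
    using continuous_on_tendsto_compose[OF u(1) r(2)] continuous_on_tendsto_compose[OF v(1) Yr] by auto
  have "u p - v p \<le> u x0 - v x0"
  proof (rule LIMSEQ_le_const[OF tendsto_diff[OF cu cv]], intro exI allI impI)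
    fix n
    have "0 \<le> real (Suc (r n)) * (norm (X (r n) - Y (r n)))\<^sup>2" by simp
    then show "u p - v p \<le> u ((X \<circ> r) n) - v ((Y \<circ> r) n)" using low[of "r n"] unfolding comp_apply by linarith
  qed
  then show thesis
    using that[of "\<lambda>n. real (Suc (r n))" "X \<circ> r" "Y \<circ> r" x0] max r(2) Yr p by simp
qed

section \<open>Multiples of subsolutions and bounds for functions vanishing outside \<Omega>\<close>

lemma Ck_closure_cmult:
  "Ck_closure k f U \<Longrightarrow> Ck_closure k (\<lambda>x. c * f x) U"
proof (induction k arbitrary: f)
  case 0
  then show ?case by (auto intro: continuous_intros)
next
  case (Suc k)
  then obtain G where G: "continuous_on (closure U) f" "\<forall>x\<in>U. (f has_derivative (\<lambda>h. G x \<bullet> h)) (at x)"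
    "\<forall>i. Ck_closure k (\<lambda>x. G x $ i) U" by auto
  have d: "((\<lambda>x. c * f x) has_derivative (\<lambda>h. (c *\<^sub>R G x) \<bullet> h)) (at x)" if "x \<in> U" for x
    using has_derivative_mult_right[OF G(2)[rule_format, OF that], of c] by simp
  have C: "Ck_closure k (\<lambda>x. (c *\<^sub>R G x) $ i) U" for i
    using Suc.IH[OF G(3)[rule_format, of i]] by simp
  show ?case unfolding Ck_closure.simps
    by (intro conjI exI[of _ "\<lambda>x. c *\<^sub>R G x"] ballI allI d C) (use G(1) in \<open>auto intro: continuous_intros\<close>)
qed

lemma stable_op_cmult: "stable_op s k (\<lambda>x. c * u x) x = c * stable_op s k u x"
proof -
  have "(c * u (x + y) + c * u (x - y) - 2 * (c * u x)) * K = c * ((u (x + y) + u (x - y) - 2 * u x) * K)" for y K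
    by (simp add: algebra_simps)
  then show ?thesis unfolding stable_op_def
    by (simp only: integral_mult_right_zero mult.left_commute)
qed

text \<open>If \<phi> touches \<open>c * u\<close> from above, then \<phi> / c touches
  \<open>u\<close> from above, and the operator is linear.\<close>

lemma visc_ge_cmult:
  fixes c :: real
  assumes "visc_ge (stable_op s k) \<Omega> u f" "0 < c"
  shows "visc_ge (stable_op s k) \<Omega> (\<lambda>x. c * u x) (\<lambda>x. c * f x)"
  unfolding visc_ge_def
proof (intro ballI allI impI, elim conjE)
  fix x0 N \<phi> assume *: "x0 \<in> \<Omega>" "open N" "x0 \<in> N" "N \<subseteq> \<Omega>" "Ck_closure 2 \<phi> N" "\<phi> x0 = c * u x0"
    "\<forall>x\<in>N - {x0}. c * u x < \<phi> x"
  let ?\<phi> = "\<lambda>x. (1 / c) * \<phi> x"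
  have "f x0 \<le> stable_op s k (\<lambda>x. if x \<in> N then ?\<phi> x else u x) x0"
    using * assms(2) Ck_closure_cmult[OF *(5), of "1/c"]
    by (intro assms(1)[unfolded visc_ge_def, rule_format]) (auto simp: field_simps)
  then have "c * f x0 \<le> c * stable_op s k (\<lambda>x. if x \<in> N then ?\<phi> x else u x) x0"
    using assms(2) by (intro mult_left_mono) auto
  also have "\<dots> = stable_op s k (\<lambda>x. c * (if x \<in> N then ?\<phi> x else u x)) x0" by (simp add: stable_op_cmult)
  also have "(\<lambda>x. c * (if x \<in> N then ?\<phi> x else u x)) = (\<lambda>x. if x \<in> N then \<phi> x else c * u x)"
    using assms(2) by auto
  finally show "c * f x0 \<le> stable_op s k (\<lambda>x. if x \<in> N then \<phi> x else c * u x) x0" .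
qed

lemma bounded_continuous_if_zero_outside:
  fixes u :: "'a::euclidean_space \<Rightarrow> real"
  assumes "bounded \<Omega>" "continuous_on UNIV u" "\<And>x. x \<notin> \<Omega> \<Longrightarrow> u x = 0"
  obtains B where "0 < B" "\<forall>x. \<bar>u x\<bar> \<le> B"
proof -
  have "bounded (u ` closure \<Omega>)" using assms(1)
    by (intro compact_imp_bounded compact_continuous_image continuous_on_subset[OF assms(2)])
       (auto simp: compact_closure)
  then obtain B where B: "\<forall>x\<in>closure \<Omega>. \<bar>u x\<bar> \<le> B" by (auto simp: bounded_iff)
  show thesis
  proof (rule that[of "max B 1"])
    have "\<bar>u x\<bar> \<le> max B 1" for x
      using B assms(3)[of x] closure_subset[of \<Omega>] by (cases "x \<in> \<Omega>") force+
    then show "\<forall>x. \<bar>u x\<bar> \<le> max B 1" ..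
  qed simp
qed

lemma L1_weighted_if_bounded:
  fixes u :: "real^'n \<Rightarrow> real"
  assumes "0 < s" "continuous_on UNIV u" "\<And>x. \<bar>u x\<bar> \<le> B"
  shows "L1_weighted s u"
proof (rule L1_weighted_patch[OF assms(1), of "\<lambda>_. 0"])
  show "L1_weighted s (\<lambda>_::real^'n. 0)" by (simp add: L1_weighted_def)
  show "u \<in> borel_measurable borel" by (rule borel_measurable_continuous_onI[OF assms(2)])
qed (use assms(3) in simp)

section \<open>Comparison with the principal eigenfunction\<close>

locale eigen_comparison =
  fixes s lo hi m \<mu> :: real and \<L> :: "((real^'n \<Rightarrow> real) \<Rightarrow> real^'n \<Rightarrow> real) set"
    and L :: "(real^'n \<Rightarrow> real) \<Rightarrow> real^'n \<Rightarrow> real" and \<Omega> :: "(real^'n) set"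
    and \<Psi> \<psi> :: "real^'n \<Rightarrow> real"
  assumes s: "0 < s" "s < 1" and lo: "0 < lo"
    and \<L>: "\<L> \<subseteq> stable_ops s lo hi" "L \<in> \<L>"
    and \<Omega>: "open \<Omega>" "bounded \<Omega>"
    and \<Psi>: "continuous_on UNIV \<Psi>" "visc_ge L \<Omega> \<Psi> (\<lambda>x. - m * \<Psi> x)"
      "\<And>x. x \<in> \<Omega> \<Longrightarrow> 0 < \<Psi> x" "\<And>x. x \<notin> \<Omega> \<Longrightarrow> \<Psi> x = 0"
    and \<psi>: "continuous_on UNIV \<psi>" "L1_weighted s \<psi>" "\<And>x. 0 \<le> \<psi> x" "\<And>x. x \<in> \<Omega> \<Longrightarrow> 0 < \<psi> x"
      "visc_le (sup_op \<L>) \<Omega> \<psi> (\<lambda>x. - \<mu> * \<psi> x)"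
begin

lemma scaled_subsolution:
  assumes "0 < c"
  shows "continuous_on UNIV (\<lambda>x. c * \<Psi> x)" "L1_weighted s (\<lambda>x. c * \<Psi> x)"
    "visc_ge L \<Omega> (\<lambda>x. c * \<Psi> x) (\<lambda>x. - m * (c * \<Psi> x))" "x \<notin> \<Omega> \<Longrightarrow> c * \<Psi> x = 0"
proof -
  show cont: "continuous_on UNIV (\<lambda>x. c * \<Psi> x)" using \<Psi>(1) by (intro continuous_intros)
  show zero: "c * \<Psi> x = 0" if "x \<notin> \<Omega>" for x using \<Psi>(4) that by simp
  obtain B where B: "\<forall>x. \<bar>c * \<Psi> x\<bar> \<le> B"
    using bounded_continuous_if_zero_outside[OF \<Omega>(2) cont zero] by blast
  show "L1_weighted s (\<lambda>x. c * \<Psi> x)" by (rule L1_weighted_if_bounded[OF s(1) cont B[rule_format]])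
  obtain k where "L = stable_op s k" by (rule stable_ops_kernel[OF subsetD[OF \<L>]])
  with visc_ge_cmult[of s k \<Omega> \<Psi> "\<lambda>x. - m * \<Psi> x" c] \<Psi>(2) assms
  show "visc_ge L \<Omega> (\<lambda>x. c * \<Psi> x) (\<lambda>x. - m * (c * \<Psi> x))" by (simp add: mult.left_commute)
qed

text \<open>The doubling comparison holds at the maximising pairs, which eventually lie in \<Omega>;
  continuity of \<Psi> and \<psi> carries it to their common limit, where the two functions keep
  their strict order.\<close>

lemma contact_inequality:
  assumes c: "0 < c" and p: "\<psi> p < c * \<Psi> p"
  obtains x where "x \<in> \<Omega>" "\<psi> x < c * \<Psi> x" "\<mu> * \<psi> x \<le> m * (c * \<Psi> x)"
proof -
  note u = scaled_subsolution[OF c]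
  obtain a X Y x0 where a: "\<forall>n::nat. 0 \<le> a n"
    and max: "\<forall>n x y. c * \<Psi> x - \<psi> y - a n * (norm (x - y))\<^sup>2
        \<le> c * \<Psi> (X n) - \<psi> (Y n) - a n * (norm (X n - Y n))\<^sup>2"
    and lim: "X \<longlonglongrightarrow> x0" "Y \<longlonglongrightarrow> x0" and x0: "\<psi> x0 < c * \<Psi> x0"
    by (rule doubling_sequence[OF \<Omega>(2) u(1,4) \<psi>(1,3) p])
  have x\<Omega>: "x0 \<in> \<Omega>" using x0 \<psi>(3)[of x0] u(4)[of x0] by force
  have "\<forall>\<^sub>F n in sequentially. X n \<in> \<Omega> \<and> Y n \<in> \<Omega>"
    using topological_tendstoD[OF lim(1) \<Omega>(1) x\<Omega>] topological_tendstoD[OF lim(2) \<Omega>(1) x\<Omega>]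
    by (rule eventually_conj)
  then have "\<forall>\<^sub>F n in sequentially. - m * (c * \<Psi> (X n)) - (- \<mu> * \<psi> (Y n)) \<le> 0"
  proof (rule eventually_mono)
    fix n assume n: "X n \<in> \<Omega> \<and> Y n \<in> \<Omega>"
    show "- m * (c * \<Psi> (X n)) - (- \<mu> * \<psi> (Y n)) \<le> 0"
      \<comment> \<open>With \<open>S\<close> empty and \<open>M\<close> = 0 there is no gain term,
        only the comparison of the right-hand sides.\<close>
      using doubling_comparison[OF s lo \<L> u(1-3) \<psi>(1,2,5) \<Omega>(1) _ _ a[rule_format] max[rule_format], of n "{}" 1 1 0] n by simp
  qed
  moreover have "(\<lambda>n. - m * (c * \<Psi> (X n)) - (- \<mu> * \<psi> (Y n))) \<longlonglongrightarrow> - m * (c * \<Psi> x0) - (- \<mu> * \<psi> x0)"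
    by (intro tendsto_intros continuous_on_tendsto_compose[OF \<Psi>(1) lim(1)]
        continuous_on_tendsto_compose[OF \<psi>(1) lim(2)]) auto
  ultimately have "- m * (c * \<Psi> x0) - (- \<mu> * \<psi> x0) \<le> 0"
    by (intro tendsto_upperbound) auto
  then show thesis using that[OF x\<Omega> x0] by simp
qed

text \<open>
  A maximum principle for sets of small measure: where \<open>c * \<Psi> - \<psi>\<close> is positive only on a thin layer at
  the boundary, the jumps of \<open>L\<close> out of the layer outweigh the zeroth order term. No information on
  the boundary behaviour of \<open>\<Psi>\<close> and \<open>\<psi>\<close> enters.
\<close>

lemma positive_multiple_below:
  assumes m\<mu>: "m < \<mu>"
  obtains c where "0 < c" "\<forall>x. c * \<Psi> x \<le> \<psi> x"
proof -
  define q where "q = real CARD('n) + 2 * s"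
  define V where "V = unit_ball_vol (real CARD('n))"
  have V: "0 < V" by (simp add: V_def)
  define T where "T = 2 * (\<bar>m\<bar> + 1) / (lo * V)"
  have T: "0 < T" using lo V by (simp add: T_def)
  \<comment> \<open>\<open>R\<close> solves R^(-2s) = T. Then jumps to half the volume
    \<open>W\<close> of the ball of radius \<open>R\<close>, at kernel strength \<open>lo\<close> /
    R^q, have total rate exactly |m| + 1, more than the zeroth order term can absorb.\<close>
  define R where "R = T powr (- 1 / (2 * s))"
  have R: "0 < R" using T by (simp add: R_def)
  have volball: "measure lborel (ball (0::real^'n) r) = V * r ^ CARD('n)" if "0 \<le> r" for r
    using content_ball[OF that, of "0::real^'n"] by (simp add: V_def)
  define W where "W = V * R ^ CARD('n)"
  have W: "0 < W" using V R by (simp add: W_def)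
  have gain: "lo / R powr q * (W / 2) = \<bar>m\<bar> + 1"
  proof -
    have "R powr q = R ^ CARD('n) * R powr (2 * s)" using R by (simp add: q_def powr_add powr_realpow)
    moreover have "R powr (2 * s) = 1 / T"
    proof -
      have "R powr (2 * s) = T powr (- 1)" using s by (simp add: R_def powr_powr del: minus_divide_left)
      then show ?thesis using T by (simp add: powr_minus_divide)
    qed
    ultimately show ?thesis using R V lo T by (simp add: W_def T_def field_simps)
  qed
  obtain B where B: "0 < B" "\<forall>x. \<bar>\<Psi> x\<bar> \<le> B"
    by (rule bounded_continuous_if_zero_outside[OF \<Omega>(2) \<Psi>(1,4)])
  \<comment> \<open>The distance to the empty set is 0 by convention, so the description of \<Omega>
    by \<open>infdist\<close> needs a nonempty complement.\<close>
  have co: "- \<Omega> \<noteq> {}"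
  proof
    assume "- \<Omega> = {}"
    then have "\<Omega> = UNIV" by blast
    then show False using \<Omega>(2) not_bounded_UNIV by blast
  qed
  have inf: "x \<in> \<Omega> \<longleftrightarrow> 0 < infdist x (- \<Omega>)" for x
    using in_closed_iff_infdist_zero[of "- \<Omega>" x] \<Omega>(1) co infdist_nonneg[of x "- \<Omega>"] by force
  \<comment> \<open>Boundary layers of finite measure that shrink to the empty set; one of measure
    below W / 8 is chosen.\<close>
  define A where "A = (\<lambda>j::nat. {x \<in> \<Omega>. infdist x (- \<Omega>) < 1 / real (Suc j)})"
  have Aopen: "open (A j)" for j
  proof -
    have "A j = \<Omega> \<inter> {x. infdist x (- \<Omega>) < 1 / real (Suc j)}" by (auto simp: A_def)
    also have "open \<dots>" using \<Omega>(1) by (intro open_Int open_Collect_less continuous_intros)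
    finally show ?thesis .
  qed
  have "bounded (A j)" for j using bounded_subset[OF \<Omega>(2)] by (auto simp: A_def)
  then have Afin: "emeasure lborel (A j) < \<infinity>" for j by (rule emeasure_bounded_finite)
  have "(\<lambda>j. measure lborel (A j)) \<longlonglongrightarrow> measure lborel (\<Inter>j. A j)"
  proof (rule Lim_measure_decseq)
    show "range A \<subseteq> sets lborel" using Aopen by auto
    show "decseq A"
    proof (rule decseq_SucI)
      fix n
      have "1 / real (Suc (Suc n)) \<le> 1 / real (Suc n)" by (intro divide_left_mono) auto
      then show "A (Suc n) \<subseteq> A n" by (auto simp: A_def simp del: of_nat_Suc)
    qed
    show "emeasure lborel (A j) \<noteq> \<infinity>" for j using Afin[of j] by simp
  qed
  moreover have "(\<Inter>j. A j) = {}"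
  proof -
    have False if "\<forall>j. x \<in> A j" for x
    proof -
      have "0 < infdist x (- \<Omega>)" using that inf by (auto simp: A_def)
      then obtain j where "1 / real (Suc j) < infdist x (- \<Omega>)" by (metis nat_approx_posE)
      then show False using that[rule_format, of j] by (simp add: A_def)
    qed
    then show ?thesis by auto
  qed
  ultimately have "(\<lambda>j. measure lborel (A j)) \<longlonglongrightarrow> 0" by simp
  then have "\<forall>\<^sub>F j in sequentially. measure lborel (A j) < W / 8" using W by (intro order_tendstoD(2)) auto
  then obtain j where j: "measure lborel (A j) < W / 8" by (auto simp: eventually_sequentially)
  define \<eta> where "\<eta> = 1 / real (Suc j)"
  have \<eta>: "0 < \<eta>" by (simp add: \<eta>_def)
  \<comment> \<open>Half the layer width leaves room for the distance between the doubled points: if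
    X + z has depth at least \<eta>, then Y + z is still in \<open>K\<close>.\<close>
  define K where "K = {x. \<eta> / 2 \<le> infdist x (- \<Omega>)}"
  have K\<Omega>: "K \<subseteq> \<Omega>" using inf \<eta> by (force simp: K_def)
  have "closed K" unfolding K_def by (intro closed_Collect_le continuous_intros)
  then have "compact K" using bounded_subset[OF \<Omega>(2) K\<Omega>] by (simp add: compact_eq_bounded_closed)
  have "\<exists>e>0. \<forall>x\<in>K. e \<le> \<psi> x"
  proof (cases "K = {}")
    case False
    obtain z where "z \<in> K" "\<forall>x\<in>K. \<psi> z \<le> \<psi> x"
      using continuous_attains_inf[OF \<open>compact K\<close> False continuous_on_subset[OF \<psi>(1) subset_UNIV]] by blast
    then show ?thesis using \<psi>(4) K\<Omega> by blast
  qed (auto intro: exI[of _ 1])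
  then obtain e where e: "0 < e" "\<And>x. x \<in> K \<Longrightarrow> e \<le> \<psi> x" by blast
  \<comment> \<open>As \<Psi> \<le> B, everywhere c \<Psi> \<le> e, which is a lower bound of \<psi>
    on \<open>K\<close>.\<close>
  define c where "c = e / B"
  have c: "0 < c" using e B by (simp add: c_def)
  have ce: "c * \<Psi> x \<le> e" for x
  proof -
    have "e * \<Psi> x \<le> e * B" using B(2)[rule_format, of x] e by (intro mult_left_mono) auto
    then show ?thesis using B(1) by (simp add: c_def field_simps)
  qed
  have "c * \<Psi> p \<le> \<psi> p" for p
  proof (rule ccontr)
    assume "\<not> c * \<Psi> p \<le> \<psi> p"
    then have p: "\<psi> p < c * \<Psi> p" by simp
    note u = scaled_subsolution[OF c]
    obtain a X Y x0 where a: "\<forall>n::nat. 0 \<le> a n"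
      and max: "\<forall>n x y. c * \<Psi> x - \<psi> y - a n * (norm (x - y))\<^sup>2
          \<le> c * \<Psi> (X n) - \<psi> (Y n) - a n * (norm (X n - Y n))\<^sup>2"
      and lim: "X \<longlonglongrightarrow> x0" "Y \<longlonglongrightarrow> x0" and x0: "\<psi> x0 < c * \<Psi> x0"
      by (rule doubling_sequence[OF \<Omega>(2) u(1,4) \<psi>(1,3) p])
    have x\<Omega>: "x0 \<in> \<Omega>" using x0 \<psi>(3)[of x0] u(4)[of x0] by force
    have "(\<lambda>n. dist (X n) (Y n)) \<longlonglongrightarrow> 0" using tendsto_dist[OF lim] by simp
    then have "\<forall>\<^sub>F n in sequentially. dist (X n) (Y n) < \<eta> / 2" using \<eta> by (intro order_tendstoD(2)) auto
    then have "\<forall>\<^sub>F n in sequentially. (X n \<in> \<Omega> \<and> Y n \<in> \<Omega>) \<and> dist (X n) (Y n) < \<eta> / 2"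
      using topological_tendstoD[OF lim(1) \<Omega>(1) x\<Omega>] topological_tendstoD[OF lim(2) \<Omega>(1) x\<Omega>]
      by (intro eventually_conj)
    \<comment> \<open>No limit in n is taken: one pair in \<Omega> with points closer than \<eta> /
      2 yields the contradiction.\<close>
    then obtain n where n: "X n \<in> \<Omega>" "Y n \<in> \<Omega>" "dist (X n) (Y n) < \<eta> / 2"
      by (auto simp: eventually_sequentially)
    define M where "M = c * \<Psi> (X n) - \<psi> (Y n)"
    have M: "0 < M"
    proof -
      have "0 \<le> a n * (norm (X n - Y n))\<^sup>2" using a by simp
      then show ?thesis using max[rule_format, of p p n] p by (simp add: M_def)
    qed
    have outside: "c * \<Psi> (X n + z) - \<psi> (Y n + z) \<le> 0" if "X n + z \<notin> A j" for z
    proof (cases "X n + z \<in> \<Omega>")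
      case True
      then have "\<eta> \<le> infdist (X n + z) (- \<Omega>)" using that by (simp add: A_def \<eta>_def)
      also have "\<dots> \<le> infdist (Y n + z) (- \<Omega>) + dist (X n + z) (Y n + z)" by (rule infdist_triangle)
      finally have "Y n + z \<in> K" using n(3) by (simp add: K_def dist_norm)
      then show ?thesis using e(2)[of "Y n + z"] ce[of "X n + z"] by linarith
    next
      case False
      then show ?thesis using \<Psi>(4) \<psi>(3) by simp
    qed
    define P where "P = (\<lambda>z. X n + z) -` A j"
    define P' where "P' = (\<lambda>z. X n - z) -` A j"
    have PP: "P \<in> sets borel" "P' \<in> sets borel"
    proof -
      have "open P" unfolding P_def by (intro open_vimage Aopen continuous_intros)
      moreover have "open P'" unfolding P'_def by (intro open_vimage Aopen continuous_intros)
      ultimately show "P \<in> sets borel" "P' \<in> sets borel" by auto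
    qed
    have mP: "measure lborel P = measure lborel (A j)" "measure lborel P' = measure lborel (A j)"
      "emeasure lborel P = emeasure lborel (A j)" "emeasure lborel P' = emeasure lborel (A j)"
      using emeasure_lborel_reflect_translate[of "A j" "X n"] Aopen[of j]
      by (auto simp: measure_def P_def P'_def)
    \<comment> \<open>Both X + z and X - z avoid the layer for z in \<open>S\<close>. The removed
      sets cost at most W / 4 for the inner ball and W / 8 for each of \<open>P\<close> and
      \<open>P'\<close>, which leaves W / 2.\<close>
    define S where "S = (((ball 0 R - ball 0 (R / 4)) - P) - P' :: (real^'n) set)"
    have fmP: "P \<in> fmeasurable lborel" "P' \<in> fmeasurable lborel"
      using mP PP Afin[of j] by (auto simp: fmeasurable_def)
    have fmB: "ball (0::real^'n) r \<in> fmeasurable lborel" for r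
      using emeasure_lborel_ball_finite[of "0::real^'n" r] by (auto simp: fmeasurable_def)
    have cardn: "(1/4::real) ^ CARD('n) \<le> 1/4"
      using power_decreasing[of 1 "CARD('n)" "1/4::real"] by (simp add: Suc_leI)
    have small: "measure lborel (ball (0::real^'n) (R / 4)) \<le> W / 4"
    proof -
      have "measure lborel (ball (0::real^'n) (R / 4)) = W * (1/4) ^ CARD('n)"
        using R by (subst volball) (auto simp: W_def power_divide)
      also have "\<dots> \<le> W * (1/4)" using cardn W by (intro mult_left_mono) auto
      finally show ?thesis by simp
    qed
    have diff: "measure lborel C - measure lborel D \<le> measure lborel (C - D)"
      if "C \<in> fmeasurable lborel" "D \<in> fmeasurable lborel" for C D :: "(real^'n) set"
    proof -
      have "measure lborel C \<le> measure lborel (D \<union> (C - D))"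
        using that by (intro measure_mono_fmeasurable fmeasurable.Un fmeasurable.Diff) auto
      also have "\<dots> \<le> measure lborel D + measure lborel (C - D)"
        by (intro measure_Un_le sets.Diff fmeasurableD that)
      finally show ?thesis by simp
    qed
    have "W - W / 4 - W / 8 - W / 8 \<le> measure lborel S"
      using diff[OF fmB fmB, of R "R / 4"] diff[OF fmeasurable_Diff[OF fmB, of "ball 0 (R / 4)"] fmP(1), of R]
        diff[OF fmeasurable_Diff[OF fmeasurable_Diff[OF fmB, of "ball 0 (R / 4)"], of P] fmP(2), of R]
        PP small j mP volball[of R] R
      by (simp add: S_def W_def)
    then have mS: "W / 2 \<le> measure lborel S" by simp
    have "- m * (c * \<Psi> (X n)) - (- \<mu> * \<psi> (Y n)) \<le> - (M * lo / R powr q * measure lborel S)"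
      unfolding q_def
    proof (rule doubling_comparison[OF s lo \<L> u(1-3) \<psi>(1,2,5) \<Omega>(1) n(1,2) a[rule_format] max[rule_format]])
      show "S \<in> sets borel" using PP by (auto simp: S_def)
      show "R / 4 \<le> norm z \<and> norm z \<le> R" if "z \<in> S" for z using that by (auto simp: S_def)
      show "0 < R / 4" "0 \<le> M" using R M by auto
      fix z assume z: "z \<in> S"
      then have "X n + z \<notin> A j" "X n + (- z) \<notin> A j" by (auto simp: S_def P_def P'_def)
      from outside[OF this(1)] outside[OF this(2)]
      show "(c * \<Psi> (X n + z) - \<psi> (Y n + z)) + (c * \<Psi> (X n - z) - \<psi> (Y n - z))
          \<le> 2 * (c * \<Psi> (X n) - \<psi> (Y n)) - 2 * M" by (simp add: M_def)
    qed
    also have "\<dots> \<le> - (M * lo / R powr q * (W / 2))"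
      using mS M lo R by (intro le_imp_neg_le mult_left_mono) auto
    also have "M * lo / R powr q * (W / 2) = M * (\<bar>m\<bar> + 1)"
      using gain[symmetric] by simp
    finally have *: "- m * (c * \<Psi> (X n)) - (- \<mu> * \<psi> (Y n)) \<le> - (M * (\<bar>m\<bar> + 1))" .
    \<comment> \<open>Eliminating c \<Psi> separates the signs: (\<mu> - m) \<psi> is nonnegative,
      but the gain |m| + 1 makes its upper bound negative.\<close>
    have "c * \<Psi> (X n) = M + \<psi> (Y n)" by (simp add: M_def)
    then have "(\<mu> - m) * \<psi> (Y n) \<le> M * (m - \<bar>m\<bar> - 1)" using * by (simp add: algebra_simps)
    moreover have "0 \<le> (\<mu> - m) * \<psi> (Y n)" using m\<mu> \<psi>(3) by simp
    moreover have "M * (m - \<bar>m\<bar> - 1) < 0" using M by (intro mult_pos_neg) auto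
    ultimately show False by linarith
  qed
  then show thesis using that[OF c] by blast
qed

text \<open>The largest multiple of \<Psi> below \<psi> exists, and every larger multiple crosses
  \<psi>, which makes the contact inequality available arbitrarily close to it.\<close>

lemma eigenvalue_bound:
  assumes ne: "\<Omega> \<noteq> {}"
  shows "\<mu> \<le> m"
proof (rule ccontr)
  assume "\<not> \<mu> \<le> m"
  then have m\<mu>: "m < \<mu>" by simp
  obtain c0 where c0: "0 < c0" "\<forall>x. c0 * \<Psi> x \<le> \<psi> x" by (rule positive_multiple_below[OF m\<mu>])
  define E where "E = {c. \<forall>x. c * \<Psi> x \<le> \<psi> x}"
  define C where "C = Sup E"
  obtain p where p: "p \<in> \<Omega>" using ne by blast
  have bdd: "bdd_above E"
  proof (rule bdd_aboveI[of _ "\<psi> p / \<Psi> p"])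
    fix c assume "c \<in> E"
    then show "c \<le> \<psi> p / \<Psi> p" using \<Psi>(3)[OF p] by (simp add: E_def field_simps)
  qed
  have c0E: "c0 \<in> E" using c0 by (simp add: E_def)
  have C0: "0 < C" using cSup_upper[OF c0E bdd] c0 by (simp add: C_def)
  have below: "C * \<Psi> x \<le> \<psi> x" for x
  proof (cases "x \<in> \<Omega>")
    case True
    have "C \<le> \<psi> x / \<Psi> x" unfolding C_def
    proof (rule cSup_least)
      show "E \<noteq> {}" using c0E by blast
      fix c assume "c \<in> E"
      then show "c \<le> \<psi> x / \<Psi> x" using \<Psi>(3)[OF True] by (simp add: E_def field_simps)
    qed
    then show ?thesis using \<Psi>(3)[OF True] by (simp add: field_simps)
  qed (use \<Psi>(4) \<psi>(3) in simp)
  have contact: "\<exists>x\<in>\<Omega>. \<psi> x < c * \<Psi> x \<and> \<mu> * \<psi> x \<le> m * (c * \<Psi> x)" if "C < c" for c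
  proof -
    have "c \<notin> E" using cSup_upper[OF _ bdd, of c] that by (auto simp: C_def)
    then obtain y where y: "\<psi> y < c * \<Psi> y" by (auto simp: E_def not_le)
    have "0 < c" using that C0 by simp
    from contact_inequality[OF this y] show ?thesis by blast
  qed
  show False
  proof (cases "0 \<le> \<mu>")
    case True
    have ineq: "\<mu> * C \<le> m * c" if Cc: "C < c" for c
    proof -
      obtain x where x: "x \<in> \<Omega>" "\<mu> * \<psi> x \<le> m * (c * \<Psi> x)" using contact[OF Cc] by blast
      \<comment> \<open>The contact point depends on c, but dividing by \<Psi> x > 0 removes it
        before c tends to C.\<close>
      have "\<mu> * (C * \<Psi> x) \<le> \<mu> * \<psi> x" using below True by (intro mult_left_mono)
      then have "(\<mu> * C) * \<Psi> x \<le> (m * c) * \<Psi> x" using x by (simp add: algebra_simps)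
      then show ?thesis using \<Psi>(3)[OF x(1)] by simp
    qed
    have "(\<lambda>n. m * (C + 1 / real (Suc n))) \<longlonglongrightarrow> m * (C + 0)"
      by (intro tendsto_intros LIMSEQ_Suc[OF lim_const_over_n])
    then have "\<mu> * C \<le> m * (C + 0)"
      by (rule LIMSEQ_le_const) (use ineq in auto)
    then show False using m\<mu> C0 by simp
  next
    case False
    obtain x where x: "x \<in> \<Omega>" "\<psi> x < (C + 1) * \<Psi> x" "\<mu> * \<psi> x \<le> m * ((C + 1) * \<Psi> x)"
      using contact[of "C + 1"] by auto
    \<comment> \<open>Negative \<mu> reverses the strict order at the contact point, so one multiple
      above C suffices and no limit is taken.\<close>
    have "\<mu> * ((C + 1) * \<Psi> x) \<le> \<mu> * \<psi> x" using x(2) False by (intro mult_left_mono_neg) auto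
    then have "\<mu> * ((C + 1) * \<Psi> x) \<le> m * ((C + 1) * \<Psi> x)" using x(3) by linarith
    moreover have "0 < (C + 1) * \<Psi> x" using C0 \<Psi>(3)[OF x(1)] by simp
    ultimately show False using m\<mu> by (simp add: mult_le_cancel_right)
  qed
qed

end

section \<open>Negated eigenfunctions and the chain of inequalities\<close>

text \<open>Negation turns contact from above into contact from below, linearity moves the sign
  through \<open>L\<close>, and \<open>L\<close> is below the supremum at the patched function,
  whose second difference is integrable against the kernel.\<close>

lemma visc_ge_sup_op_uminus:
  fixes \<Psi> :: "real^'n \<Rightarrow> real"
  assumes s: "0 < s" "s < 1" and lo: "0 < lo" and \<L>: "\<L> \<subseteq> stable_ops s lo hi" "L \<in> \<L>"
    and \<Omega>: "bounded \<Omega>" and \<Psi>: "continuous_on UNIV \<Psi>" "L1_weighted s \<Psi>" "visc_le L \<Omega> \<Psi> f"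
  shows "visc_ge (sup_op \<L>) \<Omega> (\<lambda>x. - \<Psi> x) (\<lambda>x. - f x)"
  unfolding visc_ge_def
proof (intro ballI allI impI, elim conjE)
  fix x0 N \<phi> assume *: "x0 \<in> \<Omega>" "open N" "x0 \<in> N" "N \<subseteq> \<Omega>" "Ck_closure 2 \<phi> N" "\<phi> x0 = - \<Psi> x0"
    "\<forall>x\<in>N - {x0}. - \<Psi> x < \<phi> x"
  define v where "v = (\<lambda>x. if x \<in> N then \<phi> x else - \<Psi> x)"
  let ?\<phi> = "\<lambda>x. (- 1) * \<phi> x"
  have "?\<phi> x < \<Psi> x" if "x \<in> N - {x0}" for x
    using *(7)[rule_format, OF that] by linarith
  then have "L (\<lambda>x. if x \<in> N then ?\<phi> x else \<Psi> x) x0 \<le> f x0"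
    using * Ck_closure_cmult[OF *(5), of "- 1"]
    by (intro \<Psi>(3)[unfolded visc_le_def, rule_format]) auto
  moreover have "(\<lambda>x. if x \<in> N then ?\<phi> x else \<Psi> x) = (\<lambda>x. (- 1) * v x)" by (auto simp: v_def)
  moreover obtain k where "L = stable_op s k" by (rule stable_ops_kernel[OF subsetD[OF \<L>]])
  ultimately have "- f x0 \<le> L v x0" using stable_op_cmult[of s k "- 1" v x0] by simp
  also have "L v x0 \<le> sup_op \<L> v x0"
  proof (rule stable_op_le_sup_op[OF \<L> lo])
    have "continuous_on UNIV (\<lambda>x. - \<Psi> x)" "L1_weighted s (\<lambda>x. - \<Psi> x)"
      using \<Psi>(1,2) by (auto simp: L1_weighted_def intro: continuous_intros)
    from patched_second_difference_integrable(2)[OF s this *(2) bounded_subset[OF \<Omega> *(4)] *(3,5)]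
    show "integrable lborel (\<lambda>z. (v (x0 + z) + v (x0 - z) - 2 * v x0) / norm z powr (real CARD('n) + 2 * s))"
      by (simp add: v_def)
  qed
  finally show "- f x0 \<le> sup_op \<L> (\<lambda>x. if x \<in> N then \<phi> x else - \<Psi> x) x0" by (simp add: v_def)
qed

theorem corollary1p2:
  fixes s lo hi :: real
    and \<Omega> :: "(real^'n) set"
    and \<L> :: "((real^'n \<Rightarrow> real) \<Rightarrow> real^'n \<Rightarrow> real) set"
    and eigval :: "((real^'n \<Rightarrow> real) \<Rightarrow> real^'n \<Rightarrow> real) \<Rightarrow> real"
  assumes "0 < s" "s < 1"
    and "0 < lo" "lo \<le> hi"
    and "smooth_bounded_domain \<Omega>"
    and "\<L> \<subseteq> stable_ops s lo hi" "\<L> \<noteq> {}"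
    and "\<And>L. L \<in> \<L> \<Longrightarrow> is_principal_eigenvalue L \<Omega> (eigval L)"
  shows "Lambda_plus s \<Omega> \<L> \<le> (INF L\<in>\<L>. ereal (eigval L)) \<and>
         (INF L\<in>\<L>. ereal (eigval L)) \<le> (SUP L\<in>\<L>. ereal (eigval L)) \<and>
         (SUP L\<in>\<L>. ereal (eigval L)) \<le> Lambda_minus s \<Omega> \<L>"
proof (intro conjI)
  have dom: "open \<Omega>" "bounded \<Omega>" "\<Omega> \<noteq> {}" using assms(5) by (auto simp: smooth_bounded_domain_def)
  show "Lambda_plus s \<Omega> \<L> \<le> (INF L\<in>\<L>. ereal (eigval L))"
    unfolding Lambda_plus_def
  proof (rule Sup_least, rule INF_greatest, elim imageE CollectE exE conjE)
    fix L \<mu>' \<mu> \<psi> assume L: "L \<in> \<L>" and \<mu>: "\<mu>' = ereal \<mu>"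
      and \<psi>: "continuous_on UNIV \<psi>" "L1_weighted s \<psi>" "\<forall>x. 0 \<le> \<psi> x" "\<forall>x\<in>\<Omega>. 0 < \<psi> x"
        "visc_le (sup_op \<L>) \<Omega> \<psi> (\<lambda>x. - \<mu> * \<psi> x)"
    obtain \<Psi> where "continuous_on UNIV \<Psi>" "visc_eq L \<Omega> \<Psi> (\<lambda>x. - eigval L * \<Psi> x)"
      "\<forall>x\<in>\<Omega>. 0 < \<Psi> x" "\<forall>x\<in>- \<Omega>. \<Psi> x = 0"
      using assms(8)[OF L] by (auto simp: is_principal_eigenvalue_def)
    \<comment> \<open>Every competitor is compared with every member of the class, which bounds the
      supremum by the infimum.\<close>
    then interpret eigen_comparison s lo hi "eigval L" \<mu> \<L> L \<Omega> \<Psi> \<psi>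
      using assms L dom \<psi> by unfold_locales (auto simp: visc_eq_def)
    show "\<mu>' \<le> ereal (eigval L)" using eigenvalue_bound[OF dom(3)] \<mu> by simp
  qed
  show "(INF L\<in>\<L>. ereal (eigval L)) \<le> (SUP L\<in>\<L>. ereal (eigval L))"
    using assms(7) by (rule INF_le_SUP)
  show "(SUP L\<in>\<L>. ereal (eigval L)) \<le> Lambda_minus s \<Omega> \<L>"
    unfolding Lambda_minus_def
  proof (rule SUP_least, rule Sup_upper, rule imageI, rule CollectI)
    fix L assume L: "L \<in> \<L>"
    obtain \<Psi> where \<Psi>: "continuous_on UNIV \<Psi>" "visc_eq L \<Omega> \<Psi> (\<lambda>x. - eigval L * \<Psi> x)"
      "\<forall>x\<in>\<Omega>. 0 < \<Psi> x" "\<forall>x\<in>- \<Omega>. \<Psi> x = 0"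
      using assms(8)[OF L] by (auto simp: is_principal_eigenvalue_def)
    have zero: "\<And>x. x \<notin> \<Omega> \<Longrightarrow> \<Psi> x = 0" using \<Psi>(4) by simp
    obtain B where B: "\<forall>x. \<bar>\<Psi> x\<bar> \<le> B"
      using bounded_continuous_if_zero_outside[OF dom(2) \<Psi>(1) zero] by blast
    have L1: "L1_weighted s \<Psi>" by (rule L1_weighted_if_bounded[OF assms(1) \<Psi>(1) B[rule_format]])
    have "visc_ge (sup_op \<L>) \<Omega> (\<lambda>x. - \<Psi> x) (\<lambda>x. - (- eigval L * \<Psi> x))"
      using \<Psi>(2) by (intro visc_ge_sup_op_uminus[OF assms(1-3,6) L dom(2) \<Psi>(1) L1]) (simp add: visc_eq_def)
    moreover have "0 \<le> \<Psi> x" for x using \<Psi>(3) zero[of x] by (cases "x \<in> \<Omega>") (auto simp: less_imp_le)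
    ultimately show "\<exists>\<psi>. continuous_on UNIV \<psi> \<and> L1_weighted s \<psi> \<and> (\<forall>x. \<psi> x \<le> 0) \<and> (\<forall>x\<in>\<Omega>. \<psi> x < 0) \<and>
        visc_ge (sup_op \<L>) \<Omega> \<psi> (\<lambda>x. - eigval L * \<psi> x)"
      using \<Psi>(1,3) L1
      by (intro exI[of _ "\<lambda>x. - \<Psi> x"]) (auto simp: L1_weighted_def intro: continuous_intros)
  qed
qed

end
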